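(* Let $X_n$ be the number of crossings in a uniform random labelled tree on $n$ vertices in convex position, and let $Z$ be a standard Gaussian random variable. Then, as $n\to\infty$, $\dfrac{X_n-n^2/6}{\sqrt{n^3/45}}$ converges in distribution to $Z$, with convergence rate $n^{-1/2}$ in the following sense: there is a constant $C$, independent of $n$, such that for all $n \ge 4$ $$\sup_{z\in\mathbb{R}}\left|\mathbb{P}\left(\frac{X_n-n^2/6}{\sqrt{n^3/45}}\le z\right)-\mathbb{P}(Z\le z)\right|\le \frac{C}{\sqrt{n}}.$$
   Context: A uniform random labelled tree $T_n$ on $n$ vertices is a tree chosen uniformly at random among the $n^{n-2}$ trees with vertex set $[n]=\{1,\dots,n\}$. The vertices are placed in convex position, labelled $1,\dots,n$ in cyclic order, and edges are drawn as straight segments. The number of crossings of $T_n$ is $$X_n=\sum_{1\le a<b<c<d\le n}\mathbb{I}_{a\sim c}\,\mathbb{I}_{b\sim d},$$ where $\mathbb{I}_{u\sim v}$ is the indicator that $\{u,v\}$ is an edge of $T_n$. *)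

theory Defs
  imports "HOL-Probability.Probability"
begin

text \<open>
  A finite simple graph is given by its vertex set and its set of edges, each edge being an
  unordered pair of distinct vertices.
\<close>

definition simple_graph :: "'a set \<Rightarrow> 'a set set \<Rightarrow> bool" where
  "simple_graph V E \<longleftrightarrow> finite V \<and> (\<forall>e\<in>E. \<exists>u\<in>V. \<exists>v\<in>V. u \<noteq> v \<and> e = {u, v})"

definition graph_connected :: "'a set \<Rightarrow> 'a set set \<Rightarrow> bool" where
  "graph_connected V E \<longleftrightarrow>
     V \<noteq> {} \<and> (\<forall>u\<in>V. \<forall>v\<in>V. (u, v) \<in> {(x, y). {x, y} \<in> E}\<^sup>*)"

definition graph_cycle :: "'a set set \<Rightarrow> 'a list \<Rightarrow> bool" where
  "graph_cycle E xs \<longleftrightarrow>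
     distinct xs \<and> 3 \<le> length xs \<and>
     (\<forall>i<length xs. {xs ! i, xs ! (Suc i mod length xs)} \<in> E)"

definition is_tree :: "'a set \<Rightarrow> 'a set set \<Rightarrow> bool" where
  "is_tree V E \<longleftrightarrow> simple_graph V E \<and> graph_connected V E \<and> (\<nexists>xs. graph_cycle E xs)"

definition labelled_trees :: "nat \<Rightarrow> nat set set set" where
  "labelled_trees n = {E. is_tree {1..n} E}"

text \<open>
  The set of labelled trees is finite, and nonempty for \<open>n \<ge> 1\<close>, so that
  \<^const>\<open>pmf_of_set\<close> is the uniform distribution. For \<open>n = 0\<close> its value is unspecified.
\<close>

lemma finite_labelled_trees: "finite (labelled_trees n)"
proof (rule finite_subset)
  show "labelled_trees n \<subseteq> Pow (Pow {1..n})"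
    by (fastforce simp: labelled_trees_def is_tree_def simple_graph_def)
qed simp

lemma labelled_trees_nonempty:
  assumes "n \<ge> 1"
  shows "labelled_trees n \<noteq> {}"
proof -
  define E where "E = {{1, v} | v. v \<in> {2..n}}"
  have "simple_graph {1..n} E"
    unfolding simple_graph_def
  proof (intro conjI ballI)
    fix e assume "e \<in> E"
    then obtain v where v: "v \<in> {2..n}" "e = {1, v}" by (auto simp: E_def)
    have "1 \<in> {1..n}" "v \<in> {1..n}" "1 \<noteq> v" using v(1) by auto
    with v(2) show "\<exists>u\<in>{1..n}. \<exists>v\<in>{1..n}. u \<noteq> v \<and> e = {u, v}" by blast
  qed simp
  moreover have "graph_connected {1..n} E"
    unfolding graph_connected_def
  proof (intro conjI ballI)
    let ?R = "{(x, y). {x, y} \<in> E}"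
    show "{1..n} \<noteq> {}" using assms by simp
    fix u v assume uv: "u \<in> {1..n}" "v \<in> {1..n}"
    have to: "(1, w) \<in> ?R\<^sup>*" and fro: "(w, 1) \<in> ?R\<^sup>*" if "w \<in> {1..n}" for w
    proof -
      have "w = 1 \<or> {1, w} \<in> E" using that by (cases "w = 1") (auto simp: E_def)
      then have "w = 1 \<or> (1, w) \<in> ?R \<and> (w, 1) \<in> ?R" by (simp add: insert_commute)
      then show "(1, w) \<in> ?R\<^sup>*" "(w, 1) \<in> ?R\<^sup>*" by blast+
    qed
    show "(u, v) \<in> ?R\<^sup>*" using fro[OF uv(1)] to[OF uv(2)] by (rule rtrancl_trans)
  qed
  moreover have "\<not> graph_cycle E xs" for xs
  proof
    assume cyc: "graph_cycle E xs"
    then have d: "distinct xs" and l: "3 \<le> length xs"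
      and e: "\<And>i. i < length xs \<Longrightarrow> {xs ! i, xs ! (Suc i mod length xs)} \<in> E"
      by (auto simp: graph_cycle_def)
    have one: "1 \<in> e" if "e \<in> E" for e using that by (auto simp: E_def)
    have one': "xs ! i = 1 \<or> xs ! (Suc i mod length xs) = 1" if "i < length xs" for i
      using one[OF e[OF that]] by auto
    have inj: "xs ! i = xs ! j \<longleftrightarrow> i = j" if "i < length xs" "j < length xs" for i j
      using d that by (rule nth_eq_iff_index_eq)
    have lt: "0 < length xs" "1 < length xs" "2 < length xs" using l by linarith+
    have m: "Suc 0 mod length xs = 1" "Suc 1 mod length xs = 2"
      using l by (simp_all add: mod_less)
    have 0: "xs ! 0 = 1 \<or> xs ! 1 = 1"
      using one'[OF lt(1)] unfolding m .
    have 1: "xs ! 1 = 1 \<or> xs ! 2 = 1"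
      using one'[OF lt(2)] unfolding m .
    have "xs ! 0 \<noteq> xs ! 2" unfolding inj[OF lt(1,3)] by simp
    with 0 1 have x1: "xs ! 1 = 1" by metis
    define j where "j = Suc 2 mod length xs"
    have "j \<noteq> 1"
    proof (cases "length xs = 3")
      case False
      with l have "3 < length xs" by simp
      then show ?thesis by (simp add: j_def)
    qed (simp add: j_def)
    have jl: "j < length xs" unfolding j_def by (rule mod_less_divisor[OF lt(1)])
    have "xs ! 2 \<noteq> xs ! 1" unfolding inj[OF lt(3,2)] by simp
    moreover have "xs ! j \<noteq> xs ! 1" unfolding inj[OF jl lt(2)] by (rule \<open>j \<noteq> 1\<close>)
    moreover have "xs ! 2 = 1 \<or> xs ! j = 1"
      using one'[OF lt(3)] unfolding j_def .
    ultimately show False using x1 by metis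
  qed
  ultimately show ?thesis by (auto simp: labelled_trees_def is_tree_def)
qed

definition random_tree :: "nat \<Rightarrow> nat set set pmf" where
  "random_tree n = pmf_of_set (labelled_trees n)"

text \<open>
  With the vertices \<open>1, \<dots>, n\<close> in convex position in cyclic order, two edges cross iff their
  endpoints alternate, i.e. iff they are \<open>{a, c}\<close> and \<open>{b, d}\<close> with \<open>a < b < c < d\<close>.
\<close>

definition crossings :: "nat \<Rightarrow> nat set set \<Rightarrow> nat" where
  "crossings n E =
     (\<Sum>(a, b, c, d) \<in> {(a, b, c, d). 1 \<le> a \<and> a < b \<and> b < c \<and> c < d \<and> d \<le> n}.
        of_bool ({a, c} \<in> E) * of_bool ({b, d} \<in> E))"

lemma finite_crossing_quadruples:
  "finite {(a, b, c, d). 1 \<le> a \<and> a < b \<and> b < c \<and> c < d \<and> d \<le> (n::nat)}"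
  by (rule finite_subset[of _ "{..n} \<times> {..n} \<times> {..n} \<times> {..n}"]) auto

definition normalized_crossings :: "nat \<Rightarrow> nat set set \<Rightarrow> real" where
  "normalized_crossings n E = (real (crossings n E) - real n ^ 2 / 6) / sqrt (real n ^ 3 / 45)"

end

theory Submission
  imports Defs "HOL-Real_Asymp.Real_Asymp"
begin

text \<open>
  For a tree \<open>T\<close> and an ordered pair \<open>v \<noteq> x\<close> of vertices let \<open>u\<close> be the neighbour of \<open>v\<close> on the path
  from \<open>v\<close> to \<open>x\<close>, and replace the edge \<open>{v, u}\<close> by \<open>{v, x}\<close>. This gives a tree \<open>T'\<close>, in which the path
  from \<open>v\<close> to \<open>u\<close> starts with the edge \<open>{v, x}\<close>; so \<open>(T, v, x) \<mapsto> (T', v, u)\<close> is an involution. Each edge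
  of \<open>T\<close> is the removed one for exactly \<open>n\<close> of the pairs \<open>(v, x)\<close>, whence, for symmetric \<open>w\<close>,
  \<open>n \<cdot> E[(\<Sum>e\<in>T. w(e)) F(T)] = E[\<Sum>v\<noteq>x. w(v, x) F(T')]\<close> for every function \<open>F\<close> of the tree.

  Since edges with a common end point do not cross, the swap changes the number of crossings by
  \<open>cr(v, x) - cr(v, u)\<close>, where \<open>cr(v, x)\<close> counts the edges of \<open>T\<close> crossing the chord \<open>vx\<close>. Applied to
  the crossing number itself, the identity becomes an exact Stein identity for an exchangeable pair
  with jumps of order \<open>n\<close>, up to the fluctuations of \<open>cr\<close> around its mean, and these have variance \<open>O(n)\<close>
  by the same identity. Stein's method for bounded jumps then gives the rate, once the sum of the
  squared jumps is shown to be concentrated. The only delicate term there is a sum of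
  \<open>w(v, x) w(v, u)\<close> with \<open>w\<close> of vanishing row sums; it is small because exchanging the labels of
  \<open>x\<close> and another vertex \<open>y\<close> rarely affects the first edge of any path that matters.
\<close>

subsection \<open>Trees and edge swaps\<close>

text \<open>The number 45 is forced by the chord geometry. The centred counts
  \<open>centred_chords\<close> have square sum about n^6/180 over ordered pairs; a jump is about
  2/n times the difference of two of them, and the Stein identity carries the prefactor 1/(2n). So
  the squared jumps contribute about (1/(2n)) * (4/n^2) * 2 * n^6/180 = n^3/45. The obstacle is the
  indicator as test function: the solution of Stein's equation has a kink at z, and no second-order
  expansion holds when the crossing number lies within one jump of z. After scaling, jumps have
  order n^(-1/2), so the rate survives only if this window has probability O(n^(-1/2)). The Stein
  identity itself supplies that bound, applied to a clipped linear function. No independence and no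
  linear regression property is used. The sum over all swaps stays inside the expectation, and what
  is missing from an exact relation is carried along as an error. Errors are needed only in mean
  absolute value, so second moments suffice.\<close>

definition conn :: "'a set set \<Rightarrow> 'a \<Rightarrow> 'a \<Rightarrow> bool" where
  "conn G a b \<longleftrightarrow> (a, b) \<in> {(x, y). {x, y} \<in> G}\<^sup>*"

lemma conn_refl [simp, intro]: "conn G a a"
  by (simp add: conn_def)

lemma conn_edge: "{a, b} \<in> G \<Longrightarrow> conn G a b"
  by (auto simp: conn_def)

lemma conn_trans: "conn G a b \<Longrightarrow> conn G b c \<Longrightarrow> conn G a c"
  unfolding conn_def by (rule rtrancl_trans)

lemma conn_sym: "conn G a b \<Longrightarrow> conn G b a"
proof -
  have "sym {(x, y). {x, y} \<in> G}"
    by (auto simp: sym_def insert_commute)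
  then have "sym ({(x, y). {x, y} \<in> G}\<^sup>*)"
    by (rule sym_rtrancl)
  then show "conn G a b \<Longrightarrow> conn G b a"
    unfolding conn_def sym_def by blast
qed

lemma conn_mono: "conn G a b \<Longrightarrow> G \<subseteq> H \<Longrightarrow> conn H a b"
  unfolding conn_def by (erule rtrancl_mono[THEN subsetD, rotated]) auto

lemma conn_induct [consumes 1, case_names refl step]:
  assumes "conn G a b" "P a"
    and "\<And>y z. conn G a y \<Longrightarrow> {y, z} \<in> G \<Longrightarrow> P y \<Longrightarrow> P z"
  shows "P b"
  using assms(1)[unfolded conn_def]
proof (induction rule: rtrancl_induct)
  case base
  show ?case by (rule assms(2))
next
  case (step y z)
  then show ?case using assms(3)[of y z] by (simp add: conn_def)
qed

text \<open>A walk can be shortened so that it uses the new edge at most once; the cases record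
  whether it does and in which direction.\<close>

lemma conn_insert:
  assumes "conn (insert {p, q} G) a b"
  shows "conn G a b \<or> conn G a p \<and> conn G q b \<or> conn G a q \<and> conn G p b"
  using assms
proof (induction rule: conn_induct)
  case refl
  show ?case by simp
next
  case (step y z)
  show ?case
  proof (cases "{y, z} \<in> G")
    case True
    then show ?thesis using step.IH conn_trans[OF _ conn_edge[OF True]] by blast
  next
    case False
    with step.hyps have "y = p \<and> z = q \<or> y = q \<and> z = p"
      by (auto simp: doubleton_eq_iff)
    then show ?thesis using step.IH conn_refl by metis
  qed
qed

lemma conn_image:
  assumes "conn G a b"
  shows "conn ((`) f ` G) (f a) (f b)"
  using assms
proof (induction rule: conn_induct)
  case (step y z)
  have "{f y, f z} \<in> (`) f ` G"
    using imageI[OF step.hyps(2), of "(`) f"] by simp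
  then show ?case using conn_trans[OF step.IH conn_edge] by blast
qed simp

lemma conn_simple_path:
  assumes "conn G a b"
  shows "\<exists>xs. xs \<noteq> [] \<and> hd xs = a \<and> last xs = b \<and> distinct xs \<and> successively (\<lambda>x y. {x, y} \<in> G) xs"
  using assms
proof (induction rule: conn_induct)
  case refl
  show ?case by (intro exI[of _ "[a]"]) simp
next
  case (step y z)
  then obtain xs where xs: "xs \<noteq> []" "hd xs = a" "last xs = y" "distinct xs"
    "successively (\<lambda>x y. {x, y} \<in> G) xs" by blast
  show ?case
  proof (cases "z \<in> set xs")
    case True
    then obtain ys zs where s: "xs = ys @ z # zs" by (auto dest: split_list)
    have "successively (\<lambda>x y. {x, y} \<in> G) (ys @ [z])"
      using xs(5) unfolding s by (auto simp: successively_append_iff)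
    moreover have "hd (ys @ [z]) = a"
      using xs(2) unfolding s by (cases ys) auto
    ultimately show ?thesis
      using xs(4) s by (intro exI[of _ "ys @ [z]"]) auto
  next
    case False
    have "successively (\<lambda>x y. {x, y} \<in> G) (xs @ [z])"
      using xs step.hyps(2) by (auto simp: successively_append_iff)
    then show ?thesis
      using xs False by (intro exI[of _ "xs @ [z]"]) auto
  qed
qed

lemma simple_graph_edgeD:
  assumes "simple_graph V E" "{a, b} \<in> E"
  shows "a \<in> V" "b \<in> V" "a \<noteq> b"
proof -
  obtain u v where "u \<in> V" "v \<in> V" "u \<noteq> v" "{a, b} = {u, v}"
    using assms unfolding simple_graph_def by blast
  then show "a \<in> V" "b \<in> V" "a \<noteq> b"
    by (auto simp: doubleton_eq_iff)
qed

text \<open>The edge in question closes the cycle from its last vertex to its first; the rest of the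
  cycle still joins the two ends.\<close>

lemma cycle_imp_non_bridge:
  assumes c: "graph_cycle E xs"
  shows "\<exists>u v. {u, v} \<in> E \<and> conn (E - {{u, v}}) u v"
proof -
  define L where "L = length xs"
  have d: "distinct xs" and L: "3 \<le> L"
    and e: "\<And>i. i < L \<Longrightarrow> {xs ! i, xs ! (Suc i mod L)} \<in> E"
    using c unfolding graph_cycle_def L_def by auto
  have inj: "xs ! i = xs ! j \<longleftrightarrow> i = j" if "i < L" "j < L" for i j
    using d that unfolding L_def by (rule nth_eq_iff_index_eq)
  let ?e = "{xs ! 0, xs ! (L - 1)}"
  have "{xs ! (L - 1), xs ! (Suc (L - 1) mod L)} \<in> E"
    using L by (intro e) simp
  then have eE: "?e \<in> E" using L by (simp add: insert_commute)
  have "i < L \<Longrightarrow> conn (E - {?e}) (xs ! 0) (xs ! i)" for i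
  proof (induction i)
    case (Suc i)
    have "{xs ! i, xs ! Suc i} \<in> E" using e[of i] Suc.prems by simp
    moreover have "{xs ! i, xs ! Suc i} \<noteq> ?e"
      using Suc.prems L by (auto simp: doubleton_eq_iff inj)
    ultimately have "conn (E - {?e}) (xs ! i) (xs ! Suc i)"
      by (intro conn_edge) simp
    then show ?case using conn_trans[OF Suc.IH] Suc.prems by simp
  qed simp
  then have "conn (E - {?e}) (xs ! 0) (xs ! (L - 1))" using L by simp
  with eE show ?thesis by blast
qed

lemma non_bridge_imp_cycle:
  assumes s: "simple_graph V E" and uv: "{u, v} \<in> E" and c: "conn (E - {{u, v}}) u v"
  shows "\<exists>xs. graph_cycle E xs"
proof -
  have ne: "u \<noteq> v" using simple_graph_edgeD[OF s uv] by simp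
  obtain xs where xs: "xs \<noteq> []" "hd xs = u" "last xs = v" "distinct xs"
    "successively (\<lambda>x y. {x, y} \<in> E - {{u, v}}) xs"
    using conn_simple_path[OF c] by blast
  have edge: "{xs ! i, xs ! Suc i} \<in> E - {{u, v}}" if "Suc i < length xs" for i
    using xs(5) that by (simp add: successively_conv_nth)
  have hd: "xs ! 0 = u" and la: "xs ! (length xs - 1) = v"
    using xs by (auto simp: hd_conv_nth last_conv_nth)
  have "length xs \<noteq> 1" using hd la ne by auto
  moreover have "length xs \<noteq> 2"
    using edge[of 0] hd la by auto
  moreover have "length xs \<noteq> 0" using xs by simp
  ultimately have len: "3 \<le> length xs" by linarith
  have "{xs ! i, xs ! (Suc i mod length xs)} \<in> E" if i: "i < length xs" for i
  proof (cases "Suc i < length xs")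
    case True
    then show ?thesis using edge[of i] by simp
  next
    case False
    then have "i = length xs - 1" "Suc i = length xs" using i by auto
    then show ?thesis using hd la uv by (simp add: insert_commute)
  qed
  then have "graph_cycle E xs"
    using xs(4) len by (simp add: graph_cycle_def)
  then show ?thesis by blast
qed

text \<open>Turns acyclicity into a condition on \<open>conn\<close> alone, so that preservation
  under swaps and relabellings can be checked without handling cycles as lists.\<close>

lemma is_tree_iff_bridges:
  "is_tree V E \<longleftrightarrow> simple_graph V E \<and> V \<noteq> {} \<and> (\<forall>u\<in>V. \<forall>v\<in>V. conn E u v) \<and>
     (\<forall>u v. {u, v} \<in> E \<longrightarrow> \<not> conn (E - {{u, v}}) u v)"
  unfolding is_tree_def graph_connected_def conn_def[symmetric]
  using cycle_imp_non_bridge non_bridge_imp_cycle by metis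

text \<open>The first step of the path from \<open>v\<close> to \<open>x\<close>, encoded without
  paths: the neighbour of \<open>v\<close> whose component, once all edges at \<open>v\<close> are
  deleted, contains \<open>x\<close>. In a tree no neighbour qualifies for \<open>x = v\<close>, and
  the value is then unspecified.\<close>

definition toward :: "'a set set \<Rightarrow> 'a \<Rightarrow> 'a \<Rightarrow> 'a" where
  "toward T v x = (THE u. {v, u} \<in> T \<and> conn {e \<in> T. v \<notin> e} u x)"

definition swap :: "'a set set \<Rightarrow> 'a \<Rightarrow> 'a \<Rightarrow> 'a set set" where
  "swap T v x = insert {v, x} (T - {{v, toward T v x}})"

lemma tree_bridge: "is_tree V T \<Longrightarrow> {u, v} \<in> T \<Longrightarrow> \<not> conn (T - {{u, v}}) u v"
  by (simp add: is_tree_iff_bridges)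

lemma tree_edgeD:
  assumes "is_tree V T" "{a, b} \<in> T"
  shows "a \<in> V" "b \<in> V" "a \<noteq> b"
  using simple_graph_edgeD assms unfolding is_tree_def by metis+

lemma tree_neighbours_disconnected:
  assumes t: "is_tree V T" and u: "{v, u} \<in> T" "{v, u'} \<in> T" and c: "conn {e \<in> T. v \<notin> e} u u'"
  shows "u = u'"
proof (rule ccontr)
  assume ne: "u \<noteq> u'"
  have "conn (T - {{v, u}}) u u'" using c by (rule conn_mono) auto
  moreover have "conn (T - {{v, u}}) u' v"
    using u ne by (intro conn_edge) (auto simp: insert_commute doubleton_eq_iff)
  ultimately have "conn (T - {{v, u}}) v u" by (rule conn_sym[OF conn_trans])
  with tree_bridge[OF t u(1)] show False by blast
qed

lemma toward_eqI:
  assumes t: "is_tree V T" and u: "{v, u} \<in> T" "conn {e \<in> T. v \<notin> e} u x"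
  shows "toward T v x = u"
  unfolding toward_def
proof (rule the_equality)
  fix u' assume "{v, u'} \<in> T \<and> conn {e \<in> T. v \<notin> e} u' x"
  then show "u' = u"
    using tree_neighbours_disconnected[OF t, of v u' u] u conn_trans[OF _ conn_sym[OF u(2)]] by blast
qed (use u in simp)

lemma toward_props:
  assumes t: "is_tree V T" and v: "v \<in> V" "x \<in> V" "v \<noteq> x"
  shows "{v, toward T v x} \<in> T" "conn {e \<in> T. v \<notin> e} (toward T v x) x" "toward T v x \<in> V" "toward T v x \<noteq> v"
proof -
  have "conn T v x" using t v by (simp add: is_tree_iff_bridges)
  then have "x = v \<or> (\<exists>u. {v, u} \<in> T \<and> conn {e \<in> T. v \<notin> e} u x)"
  proof (induction rule: conn_induct)
    case (step y z)
    show ?case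
    proof (cases "z = v \<or> y = v")
      case True
      then show ?thesis using step.hyps(2) by (auto simp: insert_commute)
    next
      case False
      then have "conn {e \<in> T. v \<notin> e} y z" using step.hyps(2) by (intro conn_edge) auto
      then show ?thesis using step.IH False conn_trans[OF _ \<open>conn {e \<in> T. v \<notin> e} y z\<close>] by blast
    qed
  qed simp
  then obtain u where u: "{v, u} \<in> T" "conn {e \<in> T. v \<notin> e} u x" using v by blast
  then show "{v, toward T v x} \<in> T" "conn {e \<in> T. v \<notin> e} (toward T v x) x"
    using toward_eqI[OF t u] by auto
  then show "toward T v x \<in> V" "toward T v x \<noteq> v"
    using tree_edgeD[OF t] by metis+
qed

lemma toward_adjacent:
  assumes "is_tree V T" "{v, x} \<in> T"
  shows "toward T v x = x"
  using assms by (intro toward_eqI) auto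

text \<open>Deleting \<open>{v, u}\<close> separates \<open>v\<close> from the component containing
  \<open>u\<close> and \<open>x\<close>, and \<open>{v, x}\<close> joins the two parts again. The
  work lies in showing that every other edge \<open>{p, q}\<close> remains a bridge.\<close>

lemma swap_tree:
  assumes t: "is_tree V T" and v: "v \<in> V" "x \<in> V" "v \<noteq> x"
  shows "is_tree V (swap T v x)"
proof -
  define u where "u = toward T v x"
  note nx = toward_props[OF t v, folded u_def]
  define T' where "T' = swap T v x"
  have T': "T' = insert {v, x} (T - {{v, u}})" by (simp add: T'_def swap_def u_def)
  have s: "simple_graph V T" and con: "\<And>a b. a \<in> V \<Longrightarrow> b \<in> V \<Longrightarrow> conn T a b"
    and ne: "V \<noteq> {}"
    using t by (auto simp: is_tree_iff_bridges)
  have ux: "conn (T - {{v, u}}) u x" using nx(2) by (rule conn_mono) auto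
  have s': "simple_graph V T'"
    using s v unfolding T' simple_graph_def by auto
  have base: "conn T' v u"
    by (rule conn_trans[OF conn_edge conn_sym[OF conn_mono[OF ux]]]) (auto simp: T')
  have TT': "conn T' a b" if "conn T a b" for a b
    using that
  proof (induction rule: conn_induct)
    case (step y z)
    have "conn T' y z"
    proof (cases "{y, z} = {v, u}")
      case True
      then show ?thesis using base conn_sym by (metis doubleton_eq_iff)
    next
      case False
      then show ?thesis using step.hyps(2) by (intro conn_edge) (auto simp: T')
    qed
    then show ?case by (rule conn_trans[OF step.IH])
  qed simp
  have br: "\<not> conn (T' - {{p, q}}) p q" if pq: "{p, q} \<in> T'" for p q
  proof
    assume c: "conn (T' - {{p, q}}) p q"
    show False
    proof (cases "{p, q} = {v, x}")
      case True
      have "conn (T - {{v, u}}) p q"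
        using c by (rule conn_mono) (auto simp: T' True)
      then have "conn (T - {{v, u}}) v x"
        using True by (auto simp: doubleton_eq_iff intro: conn_sym)
      then have "conn (T - {{v, u}}) v u" using conn_trans[OF _ conn_sym[OF ux]] by blast
      then show False using tree_bridge[OF t nx(1)] by blast
    next
      case False
      \<comment> \<open>\<open>G\<close> lacks both edges: \<open>c1\<close> decomposes the supposed
        connection of \<open>p\<close> and \<open>q\<close> along \<open>{v, x}\<close>, and
        \<open>c2\<close> the connection of \<open>u\<close> and \<open>x\<close> along
        \<open>{p, q}\<close>.\<close>
      define G where "G = T - {{v, u}} - {{p, q}}"
      have pqT: "{p, q} \<in> T" "{p, q} \<noteq> {v, u}" using pq False by (auto simp: T')
      have "T' - {{p, q}} = insert {v, x} G" using False by (auto simp: T' G_def)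
      then have c1: "conn G p q \<or> conn G p v \<and> conn G x q \<or> conn G p x \<and> conn G v q"
        using conn_insert c by metis
      have "T - {{v, u}} = insert {p, q} G" using pqT by (auto simp: G_def)
      then have c2: "conn G u x \<or> conn G u p \<and> conn G q x \<or> conn G u q \<and> conn G p x"
        using conn_insert ux by metis
      have n1: "\<not> conn (T - {{p, q}}) p q" using tree_bridge[OF t pqT(1)] .
      have n2: "\<not> conn (T - {{v, u}}) v u" using tree_bridge[OF t nx(1)] .
      have g1: "conn (T - {{p, q}}) a b" if "conn G a b" for a b
        using that by (rule conn_mono) (auto simp: G_def)
      have g2: "conn (T - {{v, u}}) a b" if "conn G a b" for a b
        using that by (rule conn_mono) (auto simp: G_def)
      have e1: "conn (T - {{p, q}}) v u" using nx(1) pqT by (intro conn_edge) auto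
      have no_pq: "\<not> conn G p q" using n1 g1 by blast
      have no_vu: "\<not> conn G v u" using n2 g2 by blast
      have no_px: "\<not> (conn G p x \<and> conn G x q)" using no_pq conn_trans[of G p x q] by blast
      have no_via: "\<not> (conn G a v \<and> conn G a u)" for a
        using no_vu conn_trans[OF conn_sym, of G a v u] by blast
      show False
      \<comment> \<open>If \<open>u\<close> and \<open>x\<close> are joined in \<open>G\<close>, the
        detour over \<open>u\<close> replaces the new edge, and \<open>{p, q}\<close> would not be a
        bridge of \<open>T\<close>. Otherwise each combination of \<open>c1\<close> and
        \<open>c2\<close> joins \<open>p\<close> to \<open>q\<close> through \<open>x\<close>, or
        \<open>v\<close> to \<open>u\<close> through \<open>p\<close> or \<open>q\<close>.\<close>
      proof (cases "conn G u x")
        case True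
        have vx: "conn (T - {{p, q}}) v x" using conn_trans[OF e1 g1[OF True]] .
        from c1 no_pq consider "conn G p v" "conn G x q" | "conn G p x" "conn G v q" by blast
        then show False
        proof cases
          case 1
          show False using n1 conn_trans[OF conn_trans[OF g1[OF 1(1)] vx] g1[OF 1(2)]] by simp
        next
          case 2
          show False
            using n1 conn_trans[OF conn_trans[OF g1[OF 2(1)] conn_sym[OF vx]] g1[OF 2(2)]] by simp
        qed
      next
        case False
        with c1 c2 no_pq
        have "conn G p v \<and> conn G x q \<and> conn G u p \<and> conn G q x \<or>
            conn G p v \<and> conn G x q \<and> conn G u q \<and> conn G p x \<or>
            conn G p x \<and> conn G v q \<and> conn G u p \<and> conn G q x \<or>
            conn G p x \<and> conn G v q \<and> conn G u q \<and> conn G p x" by blast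
        then show False using no_px no_via[of p] no_via[of q] by (blast dest: conn_sym)
      qed
    qed
  qed
  have con': "\<forall>a\<in>V. \<forall>b\<in>V. conn T' a b" using con TT' by blast
  have "is_tree V T'"
    unfolding is_tree_iff_bridges using s' ne con' br by simp
  then show ?thesis by (simp add: T'_def)
qed

lemma swap_avoiding: "{e \<in> swap T v x. v \<notin> e} = {e \<in> T. v \<notin> e}"
  by (auto simp: swap_def)

text \<open>Edges avoiding \<open>v\<close> are untouched, so the component condition behind
  \<open>toward\<close> is symmetric in the old and the new neighbour.\<close>

lemma toward_swap:
  assumes t: "is_tree V T" and v: "v \<in> V" "x \<in> V" "v \<noteq> x"
  shows "toward (swap T v x) v (toward T v x) = x"
proof (rule toward_eqI[OF swap_tree[OF assms]])
  show "{v, x} \<in> swap T v x" by (simp add: swap_def)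
  show "conn {e \<in> swap T v x. v \<notin> e} x (toward T v x)"
    unfolding swap_avoiding using toward_props(2)[OF assms] by (rule conn_sym)
qed

lemma not_adjacent_if_toward_neq:
  assumes "is_tree V T" "toward T v x \<noteq> x"
  shows "{v, x} \<notin> T"
  using assms toward_adjacent by metis

lemma swap_swap:
  assumes t: "is_tree V T" and v: "v \<in> V" "x \<in> V" "v \<noteq> x"
  shows "swap (swap T v x) v (toward T v x) = T"
proof (cases "toward T v x = x")
  case True
  then have "swap T v x = T" using toward_props(1)[OF assms] by (auto simp: swap_def)
  then show ?thesis using True by simp
next
  case False
  have "{v, x} \<notin> T" using not_adjacent_if_toward_neq[OF t False] .
  moreover have "{v, toward T v x} \<in> T" using toward_props(1)[OF assms] .
  moreover have "{v, x} \<noteq> {v, toward T v x}" using False by (auto simp: doubleton_eq_iff)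
  ultimately show ?thesis
    unfolding swap_def[of "swap T v x"] toward_swap[OF assms] unfolding swap_def by auto
qed

text \<open>The two sets are the sides of the edge, that is, the components left after deleting it,
  and they partition \<open>V\<close>.\<close>

lemma toward_sides:
  assumes t: "is_tree V T" and e: "{v, u} \<in> T"
  shows "card {x \<in> V - {v}. toward T v x = u} + card {x \<in> V - {u}. toward T u x = v} = card V"
proof -
  let ?A = "{x \<in> V - {v}. toward T v x = u}" and ?B = "{x \<in> V - {u}. toward T u x = v}"
  have fin: "finite V" using t by (simp add: is_tree_def simple_graph_def)
  note ed = tree_edgeD[OF t e]
  have e': "{u, v} \<in> T" using e by (simp add: insert_commute)
  have "?A \<inter> ?B = {}"
  proof -
    have False if "x \<in> ?A" "x \<in> ?B" for x
    proof -
      have "conn {e \<in> T. v \<notin> e} u x" "conn {e \<in> T. u \<notin> e} v x"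
        using that toward_props(2)[OF t, of v x] toward_props(2)[OF t, of u x] ed by auto
      then have "conn (T - {{v, u}}) u x" and vx: "conn (T - {{v, u}}) v x"
        by (fastforce intro: conn_mono)+
      then have "conn (T - {{v, u}}) v u" using conn_trans[OF vx conn_sym] by blast
      then show False using tree_bridge[OF t e] by blast
    qed
    then show ?thesis by blast
  qed
  moreover have "?A \<union> ?B = V"
  proof
    show "V \<subseteq> ?A \<union> ?B"
    proof
      fix x assume x: "x \<in> V"
      consider "x = v" | "x = u" | "x \<noteq> v" "x \<noteq> u" "toward T v x = u"
        | "x \<noteq> v" "x \<noteq> u" "toward T v x \<noteq> u" by blast
      then show "x \<in> ?A \<union> ?B"
      proof cases
        case 1
        then show ?thesis using toward_adjacent[OF t e'] ed x by simp
      next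
        case 2
        then show ?thesis using toward_adjacent[OF t e] ed x by simp
      next
        case 3
        then show ?thesis using x by simp
      next
        case 4
        define w where "w = toward T v x"
        have w: "{v, w} \<in> T" "conn {e \<in> T. v \<notin> e} w x" "w \<in> V" "w \<noteq> v"
          using toward_props[OF t, of v x] ed x 4 unfolding w_def by auto
        have wu: "w \<noteq> u" using 4 w_def by simp
        \<comment> \<open>The walk from \<open>w\<close> to \<open>x\<close> never meets
          \<open>u\<close>: otherwise two different neighbours of \<open>v\<close> would be joined
          without an edge at \<open>v\<close>.\<close>
        have "conn {e \<in> T. u \<notin> e} w x"
          using w(2)
        proof (induction rule: conn_induct)
          case (step y z)
          have "conn {e \<in> T. v \<notin> e} w z"
            using conn_trans[OF step.hyps(1) conn_edge[OF step.hyps(2)]] .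
          then have "y \<noteq> u" "z \<noteq> u"
            using step.hyps tree_neighbours_disconnected[OF t w(1) e] wu by auto
          then have "conn {e \<in> T. u \<notin> e} y z"
            using step.hyps by (intro conn_edge) auto
          then show ?case by (rule conn_trans[OF step.IH])
        qed simp
        moreover have "conn {e \<in> T. u \<notin> e} v w"
          using w wu ed by (intro conn_edge) auto
        ultimately have "conn {e \<in> T. u \<notin> e} v x" using conn_trans by fast
        then have "toward T u x = v" by (intro toward_eqI[OF t e'])
        then show ?thesis using 4 x by simp
      qed
    qed
  qed auto
  ultimately show ?thesis
    using card_Un_disjoint[of ?A ?B] fin by simp
qed

section \<open>Relabelling of trees\<close>

lemma tree_image:
  assumes t: "is_tree V T" and f: "bij f" and V: "f ` V = V"
  shows "is_tree V ((`) f ` T)"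
proof -
  have inj: "inj f" using f by (simp add: bij_is_inj)
  have s: "simple_graph V T" and con: "\<And>a b. a \<in> V \<Longrightarrow> b \<in> V \<Longrightarrow> conn T a b"
    and ne: "V \<noteq> {}"
    using t by (auto simp: is_tree_iff_bridges)
  have s': "simple_graph V ((`) f ` T)"
    unfolding simple_graph_def
  proof (intro conjI ballI)
    show "finite V" using s by (simp add: simple_graph_def)
    fix e assume "e \<in> (`) f ` T"
    then obtain e0 where e0: "e0 \<in> T" "e = f ` e0" by blast
    then obtain a b where ab: "a \<in> V" "b \<in> V" "a \<noteq> b" "e0 = {a, b}"
      using s unfolding simple_graph_def by blast
    have "f a \<in> V" "f b \<in> V" "f a \<noteq> f b" "e = {f a, f b}"
      using ab V e0 inj by (auto simp: inj_eq)
    then show "\<exists>u\<in>V. \<exists>v\<in>V. u \<noteq> v \<and> e = {u, v}" by blast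
  qed
  have con': "conn ((`) f ` T) a b" if ab: "a \<in> V" "b \<in> V" for a b
  proof -
    obtain a' b' where "a' \<in> V" "b' \<in> V" "a = f a'" "b = f b'" using ab V by (metis imageE)
    then show ?thesis using conn_image[OF con] by simp
  qed
  have br': "\<not> conn ((`) f ` T - {{a, b}}) a b" if ab: "{a, b} \<in> (`) f ` T" for a b
  proof
    assume c: "conn ((`) f ` T - {{a, b}}) a b"
    obtain e0 where e0: "e0 \<in> T" "{a, b} = f ` e0" using ab by blast
    define g where "g = inv f"
    have gf: "g (f y) = y" for y by (simp add: g_def inj)
    have "(`) g ` ((`) f ` T - {{a, b}}) \<subseteq> T - {{g a, g b}}"
    proof
      fix e assume "e \<in> (`) g ` ((`) f ` T - {{a, b}})"
      then obtain e1 where e1: "e1 \<in> T" "f ` e1 \<noteq> {a, b}" "e = g ` f ` e1" by blast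
      have "e = e1" using e1(3) by (simp add: image_image gf)
      moreover have "e1 \<noteq> {g a, g b}"
        using e1(2) f by (auto simp: g_def bij_is_surj surj_f_inv_f)
      ultimately show "e \<in> T - {{g a, g b}}" using e1(1) by simp
    qed
    then have "conn (T - {{g a, g b}}) (g a) (g b)"
      using conn_mono[OF conn_image[OF c, of g]] by simp
    moreover have "{g a, g b} = e0"
    proof -
      have "g ` {a, b} = e0" unfolding e0(2) by (simp add: image_image gf)
      then show ?thesis by simp
    qed
    ultimately show False using tree_bridge[OF t, of "g a" "g b"] e0(1) by simp
  qed
  show ?thesis
    unfolding is_tree_iff_bridges by (intro conjI ballI allI impI s' ne con' br')
qed

lemma toward_image:
  assumes t: "is_tree V T" and f: "bij f" and V: "f ` V = V"
    and v: "v \<in> V" "x \<in> V" "v \<noteq> x"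
  shows "toward ((`) f ` T) (f v) (f x) = f (toward T v x)"
proof (rule toward_eqI[OF tree_image[OF t f V]])
  note nx = toward_props[OF t v]
  show "{f v, f (toward T v x)} \<in> (`) f ` T"
    using imageI[OF nx(1), of "(`) f"] by simp
  have "(`) f ` {e \<in> T. v \<notin> e} \<subseteq> {e \<in> (`) f ` T. f v \<notin> e}"
    using bij_is_inj[OF f] by (auto simp: inj_eq)
  then show "conn {e \<in> (`) f ` T. f v \<notin> e} (f (toward T v x)) (f x)"
    using conn_mono[OF conn_image[OF nx(2), of f]] by simp
qed

subsection \<open>Stein's equation for the normal distribution\<close>

abbreviation (input) Phi :: "real \<Rightarrow> real" where
  "Phi z \<equiv> measure std_normal_distribution {..z}"

lemma Phi_eq_cdf: "Phi z = cdf std_normal_distribution z"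
  by (simp add: cdf_def)

lemma Phi_bounds: "0 \<le> Phi z" "Phi z \<le> 1"
proof -
  interpret real_distribution std_normal_distribution
    by (rule real_dist_normal_dist)
  show "0 \<le> Phi z" "Phi z \<le> 1" by (auto simp: prob_le_1)
qed

lemma Phi_mono: "x \<le> y \<Longrightarrow> Phi x \<le> Phi y"
proof -
  interpret real_distribution std_normal_distribution
    by (rule real_dist_normal_dist)
  show "x \<le> y \<Longrightarrow> Phi x \<le> Phi y" using cdf_nondecreasing unfolding Phi_eq_cdf .
qed

lemma Phi_at_top: "(Phi \<longlongrightarrow> 1) at_top"
proof -
  interpret real_distribution std_normal_distribution
    by (rule real_dist_normal_dist)
  show ?thesis using cdf_lim_at_top_prob unfolding Phi_eq_cdf .
qed

lemma Phi_at_bot: "(Phi \<longlongrightarrow> 0) at_bot"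
proof -
  interpret real_distribution std_normal_distribution
    by (rule real_dist_normal_dist)
  show ?thesis using cdf_lim_at_bot unfolding Phi_eq_cdf .
qed

lemma continuous_on_std_normal_density: "continuous_on S std_normal_density"
  unfolding std_normal_density_def by (intro continuous_intros) auto

lemma Phi_diff:
  assumes "a \<le> x"
  shows "Phi x - Phi a = integral {a..x} std_normal_density"
proof (cases "a = x")
  case False
  with assms have ax: "a < x" by simp
  interpret real_distribution std_normal_distribution
    by (rule real_dist_normal_dist)
  have int: "set_integrable lborel {a..x} std_normal_density"
    by (intro borel_integrable_atLeastAtMost' continuous_on_std_normal_density)
  have int': "set_integrable lborel {a<..x} std_normal_density"
    using int by (rule set_integrable_subset) auto
  have "Phi x - Phi a = measure std_normal_distribution {a<..x}"
    unfolding Phi_eq_cdf using cdf_diff_eq[OF ax] .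
  also have "\<dots> = (LINT t|lborel. indicator {a<..x} t * std_normal_density t)"
  proof -
    have "emeasure std_normal_distribution {a<..x}
        = (\<integral>\<^sup>+ t. ennreal (indicator {a<..x} t * std_normal_density t) \<partial>lborel)"
      by (subst emeasure_density)
        (auto intro!: nn_integral_cong simp: indicator_def)
    also have "\<dots> = ennreal (LINT t|lborel. indicator {a<..x} t * std_normal_density t)"
      using int' by (intro nn_integral_eq_integral) (auto simp: set_integrable_def)
    finally show ?thesis
      by (simp add: measure_def)
  qed
  also have "\<dots> = (LINT t:{a<..x}|lborel. std_normal_density t)"
    by (simp add: set_lebesgue_integral_def)
  also have "\<dots> = integral {a<..x} std_normal_density"
    by (rule set_borel_integral_eq_integral(2)[OF int'])
  also have "\<dots> = integral {a..x} std_normal_density"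
    by (rule integral_subset_negligible) (use ax in \<open>auto intro: negligible_subset[of "{a}"]\<close>)
  finally show ?thesis .
qed simp

lemma Phi_deriv: "(Phi has_real_derivative std_normal_density x) (at x)"
proof -
  let ?a = "x - 1" and ?b = "x + 1"
  have "((\<lambda>y. integral {?a..y} std_normal_density) has_real_derivative std_normal_density x)
      (at x within {?a..?b})"
    by (rule integral_has_real_derivative[OF continuous_on_std_normal_density]) auto
  then have "((\<lambda>y. integral {?a..y} std_normal_density) has_real_derivative std_normal_density x) (at x)"
    by (subst (asm) at_within_interior) auto
  then have "((\<lambda>y. Phi ?a + integral {?a..y} std_normal_density) has_real_derivative std_normal_density x) (at x)"
    by (auto intro!: derivative_eq_intros)
  then show ?thesis
  proof (rule has_field_derivative_transform_within[of _ _ _ _ 1])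
    fix y assume "y \<in> UNIV" "dist y x < 1"
    then have "?a \<le> y" by (auto simp: dist_real_def)
    from Phi_diff[OF this] show "Phi ?a + integral {?a..y} std_normal_density = Phi y" by simp
  qed auto
qed


lemma std_normal_density_deriv:
  "(std_normal_density has_real_derivative (- x * std_normal_density x)) (at x)"
  unfolding std_normal_density_def
  by (auto intro!: derivative_eq_intros simp: field_simps)

lemma std_normal_density_pos: "std_normal_density x > 0"
  by (simp add: normal_density_pos)

text \<open>The difference \<open>?h\<close> is strictly decreasing on the half line and tends to 0,
  hence is positive.\<close>

lemma mills_upper:
  assumes "w > 0"
  shows "w * (1 - Phi w) \<le> std_normal_density w"
proof -
  let ?h = "\<lambda>w. std_normal_density w / w - (1 - Phi w)"
  have "0 < ?h w"
  proof (rule DERIV_neg_imp_decreasing_at_top[where f = ?h])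
    fix x assume "w \<le> x"
    then have x: "x > 0" using assms by simp
    have "(?h has_real_derivative (- std_normal_density x / x\<^sup>2)) (at x)"
      using x by (auto intro!: derivative_eq_intros std_normal_density_deriv Phi_deriv
          simp: field_simps power2_eq_square)
    moreover have "- std_normal_density x / x\<^sup>2 < 0"
      using x std_normal_density_pos[of x] by (simp add: divide_neg_pos)
    ultimately show "\<exists>y. (?h has_real_derivative y) (at x) \<and> y < 0" by blast
  next
    have "((\<lambda>w::real. std_normal_density w / w) \<longlongrightarrow> 0) at_top"
      unfolding std_normal_density_def by real_asymp
    from tendsto_diff[OF this tendsto_diff[OF tendsto_const[of 1] Phi_at_top]]
    show "(?h \<longlongrightarrow> 0) at_top" by simp
  qed
  then show ?thesis using assms by (simp add: field_simps)
qed

lemma mills_lower: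
  assumes "w < 0"
  shows "- w * Phi w \<le> std_normal_density w"
proof -
  let ?h = "\<lambda>w. - std_normal_density w / w - Phi w"
  have "0 < ?h w"
  proof (rule DERIV_pos_imp_increasing_at_bot[where f = ?h])
    fix x assume "x \<le> w"
    then have x: "x < 0" using assms by simp
    have "(?h has_real_derivative (std_normal_density x / x\<^sup>2)) (at x)"
      using x by (auto intro!: derivative_eq_intros std_normal_density_deriv Phi_deriv
          simp: field_simps power2_eq_square)
    moreover have "std_normal_density x / x\<^sup>2 > 0"
      using x std_normal_density_pos[of x] by simp
    ultimately show "\<exists>y. (?h has_real_derivative y) (at x) \<and> 0 < y" by blast
  next
    have "((\<lambda>w::real. - std_normal_density w / w) \<longlongrightarrow> 0) at_bot"
      unfolding std_normal_density_def by real_asymp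
    from tendsto_diff[OF this Phi_at_bot]
    show "(?h \<longlongrightarrow> 0) at_bot" by simp
  qed
  then show ?thesis using assms by (simp add: field_simps)
qed

text \<open>The 6 is 3 * 2, from \<open>sqrt (2 * pi) \<le> 3\<close> and
  \<open>exp (1 / 2) \<le> 2\<close>; sharper values would only change the final constant.\<close>

lemma inverse_density_le:
  assumes "\<bar>w\<bar> \<le> 1"
  shows "1 / std_normal_density w \<le> 6"
proof -
  have "w\<^sup>2 \<le> 1" using assms by (simp add: abs_square_le_1)
  then have "exp (w\<^sup>2 / 2) \<le> exp (1 / 2)" by simp
  also have "\<dots> \<le> 2" using exp_bound[of "1/2"] by (simp add: power2_eq_square)
  finally have e: "exp (w\<^sup>2 / 2) \<le> 2" .
  have "2 * pi \<le> 9" using pi_less_4 by simp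
  then have "sqrt (2 * pi) \<le> 3" by (intro real_le_lsqrt) (auto simp: power2_eq_square)
  then have "sqrt (2 * pi) * exp (w\<^sup>2 / 2) \<le> 3 * 2" using e by (intro mult_mono) auto
  moreover have "1 / std_normal_density w = sqrt (2 * pi) * exp (w\<^sup>2 / 2)"
    by (simp add: std_normal_density_def exp_minus field_simps)
  ultimately show ?thesis by simp
qed

text \<open>The bounded solution of f'(w) - w f(w) = 1[w <= z] - Phi(z). The branches agree at
  \<open>w = z\<close>, where the derivative drops by 1.\<close>

definition stein_sol :: "real \<Rightarrow> real \<Rightarrow> real" where
  "stein_sol z w =
     (if w \<le> z then (1 - Phi z) * Phi w / std_normal_density w
      else Phi z * (1 - Phi w) / std_normal_density w)"

text \<open>
  The derivative of \<open>stein_sol z\<close>, except at \<open>z\<close>, where it is the left derivative.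
\<close>

definition stein_der :: "real \<Rightarrow> real \<Rightarrow> real" where
  "stein_der z w = w * stein_sol z w + of_bool (w \<le> z) - Phi z"

lemma stein_left_deriv:
  "((\<lambda>w. (1 - Phi z) * Phi w / std_normal_density w) has_real_derivative
     (w * ((1 - Phi z) * Phi w / std_normal_density w) + (1 - Phi z))) (at w)"
  using std_normal_density_pos[of w]
  by (auto intro!: derivative_eq_intros std_normal_density_deriv Phi_deriv simp: field_simps)

lemma stein_right_deriv:
  "((\<lambda>w. Phi z * (1 - Phi w) / std_normal_density w) has_real_derivative
     (w * (Phi z * (1 - Phi w) / std_normal_density w) - Phi z)) (at w)"
  using std_normal_density_pos[of w]
  by (auto intro!: derivative_eq_intros std_normal_density_deriv Phi_deriv simp: field_simps)

lemma stein_sol_nonneg: "0 \<le> stein_sol z w"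
  using Phi_bounds[of z] Phi_bounds[of w] by (auto simp: stein_sol_def)

text \<open>Monotonicity of \<open>Phi\<close> makes both ratios available on either branch, so the
  Mills bound can be chosen by the sign of \<open>w\<close> regardless of \<open>z\<close>.\<close>

lemma stein_sol_le_ratios:
  "stein_sol z w \<le> Phi w / std_normal_density w"
  "stein_sol z w \<le> (1 - Phi w) / std_normal_density w"
  "stein_sol z w \<le> 1 / std_normal_density w"
proof -
  note pos = std_normal_density_pos[of w] and b = Phi_bounds[of w] Phi_bounds[of z]
  have "(1 - Phi z) * Phi w \<le> Phi w" using b by (simp add: mult_left_le_one_le)
  moreover have "(1 - Phi z) * Phi w \<le> 1 - Phi w" if "w \<le> z"
  proof -
    have "(1 - Phi z) * Phi w \<le> (1 - Phi w) * 1"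
      using b Phi_mono[OF that] by (intro mult_mono) auto
    then show ?thesis by simp
  qed
  moreover have "Phi z * (1 - Phi w) \<le> 1 - Phi w" using b by (simp add: mult_left_le_one_le)
  moreover have "Phi z * (1 - Phi w) \<le> Phi w" if "\<not> w \<le> z"
  proof -
    have "Phi z * (1 - Phi w) \<le> Phi w * 1"
      using b Phi_mono[of z w] that by (intro mult_mono) auto
    then show ?thesis by simp
  qed
  ultimately show "stein_sol z w \<le> Phi w / std_normal_density w"
    and 2: "stein_sol z w \<le> (1 - Phi w) / std_normal_density w"
    using pos by (auto simp: stein_sol_def intro!: divide_right_mono)
  have "(1 - Phi w) / std_normal_density w \<le> 1 / std_normal_density w"
    using b pos by (intro divide_right_mono) auto
  with 2 show "stein_sol z w \<le> 1 / std_normal_density w" by simp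
qed

lemma abs_times_stein_sol: "\<bar>w * stein_sol z w\<bar> \<le> 1"
proof -
  note pos = std_normal_density_pos[of w]
  have "\<bar>w\<bar> * stein_sol z w \<le> 1"
  proof (cases "w < 0" "w = 0" rule: bool.exhaust[case_product bool.exhaust])
    case True_True then show ?thesis by simp
  next
    case True_False
    have "\<bar>w\<bar> * stein_sol z w \<le> \<bar>w\<bar> * (Phi w / std_normal_density w)"
      by (intro mult_left_mono stein_sol_le_ratios) auto
    also have "\<dots> = - w * (Phi w / std_normal_density w)" using True_False by simp
    also have "\<dots> \<le> 1" using mills_lower[of w] pos True_False by (simp add: field_simps)
    finally show ?thesis .
  next
    case False_True then show ?thesis by simp
  next
    case False_False
    have "\<bar>w\<bar> * stein_sol z w \<le> \<bar>w\<bar> * ((1 - Phi w) / std_normal_density w)"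
      by (intro mult_left_mono stein_sol_le_ratios) auto
    also have "\<dots> = w * ((1 - Phi w) / std_normal_density w)" using False_False by simp
    also have "\<dots> \<le> 1" using mills_upper[of w] pos False_False by (simp add: field_simps)
    finally show ?thesis .
  qed
  then show ?thesis using stein_sol_nonneg[of z w] by (simp add: abs_mult)
qed

lemma abs_stein_sol: "\<bar>stein_sol z w\<bar> \<le> 6"
proof (cases "\<bar>w\<bar> \<le> 1")
  case True
  then show ?thesis
    using stein_sol_le_ratios(3)[of z w] inverse_density_le[of w] stein_sol_nonneg[of z w] by simp
next
  case False
  then have "1 * \<bar>stein_sol z w\<bar> \<le> \<bar>w\<bar> * \<bar>stein_sol z w\<bar>" by (intro mult_right_mono) auto
  also have "\<dots> \<le> 1" using abs_times_stein_sol[of w z] by (simp add: abs_mult)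
  finally show ?thesis by simp
qed

lemma abs_stein_der: "\<bar>stein_der z w\<bar> \<le> 2"
proof -
  have "\<bar>of_bool (w \<le> z) - Phi z\<bar> \<le> 1" using Phi_bounds[of z] by auto
  then show ?thesis using abs_times_stein_sol[of w z] unfolding stein_der_def by linarith
qed

text \<open>Away from the kink the solution is one smooth branch. Intervals starting at
  \<open>z\<close> are covered too, as the branches share their value there.\<close>

lemma stein_sol_mvt:
  assumes "a < b" and side: "b \<le> z \<or> z \<le> a"
  obtains x where "a < x" "x < b" "stein_sol z b - stein_sol z a = (b - a) * stein_der z x"
proof -
  from side consider "b \<le> z" | "z \<le> a" by blast
  then show ?thesis
  proof cases
    case 1
    obtain x where x: "a < x" "x < b"
      "(1 - Phi z) * Phi b / std_normal_density b - (1 - Phi z) * Phi a / std_normal_density a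
        = (b - a) * (x * ((1 - Phi z) * Phi x / std_normal_density x) + (1 - Phi z))"
      using MVT2[OF assms(1) stein_left_deriv[of z]] by blast
    with 1 assms(1) show ?thesis
      by (intro that[of x]) (auto simp: stein_sol_def stein_der_def)
  next
    case 2
    obtain x where x: "a < x" "x < b"
      "Phi z * (1 - Phi b) / std_normal_density b - Phi z * (1 - Phi a) / std_normal_density a
        = (b - a) * (x * (Phi z * (1 - Phi x) / std_normal_density x) - Phi z)"
      using MVT2[OF assms(1) stein_right_deriv[of z]] by blast
    have "stein_sol z a = Phi z * (1 - Phi a) / std_normal_density a"
      using 2 by (auto simp: stein_sol_def mult.commute)
    with 2 assms(1) x show ?thesis
      by (intro that[of x]) (auto simp: stein_sol_def stein_der_def)
  qed
qed

lemma stein_sol_lipschitz_aux: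
  assumes "a \<le> b"
  shows "\<bar>stein_sol z b - stein_sol z a\<bar> \<le> 2 * (b - a)"
proof -
  have one_side: "\<bar>stein_sol z b - stein_sol z a\<bar> \<le> 2 * (b - a)"
    if ab: "a \<le> b" and side: "b \<le> z \<or> z \<le> a" for a b
  proof (cases "a = b")
    case False
    with ab have "a < b" by simp
    from stein_sol_mvt[OF this side] obtain x
      where "stein_sol z b - stein_sol z a = (b - a) * stein_der z x" by metis
    then have "\<bar>stein_sol z b - stein_sol z a\<bar> = (b - a) * \<bar>stein_der z x\<bar>"
      using ab by (simp add: abs_mult)
    also have "\<dots> \<le> (b - a) * 2" using ab abs_stein_der by (intro mult_left_mono) auto
    finally show ?thesis by simp
  qed simp
  show ?thesis
  proof (cases "b \<le> z \<or> z \<le> a")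
    case True
    then show ?thesis using one_side assms by blast
  next
    case False
    then have "\<bar>stein_sol z z - stein_sol z a\<bar> \<le> 2 * (z - a)"
      "\<bar>stein_sol z b - stein_sol z z\<bar> \<le> 2 * (b - z)"
      using False one_side[of a z] one_side[of z b] by simp_all
    then show ?thesis unfolding abs_le_iff right_diff_distrib by linarith
  qed
qed

lemma stein_sol_lipschitz: "\<bar>stein_sol z (w + s) - stein_sol z w\<bar> \<le> 2 * \<bar>s\<bar>"
  using stein_sol_lipschitz_aux[of w "w + s" z] stein_sol_lipschitz_aux[of "w + s" w z]
  by (cases "s \<ge> 0") auto

text \<open>If the kink is within reach of the jump, only crude bounds are left: 2 for the increment
  plus 2 for the derivative give the 4. Otherwise the indicator in \<open>stein_der\<close> is
  constant along the jump, and the mean value theorem leaves a second-order error.\<close>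

lemma stein_sol_increment:
  "\<bar>stein_sol z (w + s) - stein_sol z w - s * stein_der z w\<bar>
     \<le> s\<^sup>2 * (6 + 2 * (\<bar>w\<bar> + \<bar>s\<bar>)) + 4 * \<bar>s\<bar> * of_bool (\<bar>w - z\<bar> \<le> \<bar>s\<bar>)"
proof (cases "\<bar>w - z\<bar> \<le> \<bar>s\<bar>")
  case True
  have "\<bar>s * stein_der z w\<bar> \<le> \<bar>s\<bar> * 2"
    unfolding abs_mult using abs_stein_der by (intro mult_left_mono) auto
  moreover have "0 \<le> s\<^sup>2 * (6 + 2 * (\<bar>w\<bar> + \<bar>s\<bar>))" by simp
  ultimately show ?thesis using stein_sol_lipschitz[of z w s] True
    unfolding of_bool_def by (simp only: if_True mult_1_right) linarith
next
  case False
  show ?thesis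
  proof (cases "s = 0")
    case s: False
    have "\<exists>x. \<bar>x - w\<bar> \<le> \<bar>s\<bar> \<and> (x \<le> z \<longleftrightarrow> w \<le> z) \<and>
        stein_sol z (w + s) - stein_sol z w = s * stein_der z x"
    proof (cases "s > 0")
      case True
      then have "w < w + s" by simp
      moreover have "w + s \<le> z \<or> z \<le> w" using False True by auto
      ultimately obtain x where "w < x" "x < w + s"
        "stein_sol z (w + s) - stein_sol z w = (w + s - w) * stein_der z x"
        by (rule stein_sol_mvt)
      then show ?thesis using False by (intro exI[of _ x]) auto
    next
      case neg: False
      then have "w + s < w" using s by simp
      moreover have "w \<le> z \<or> z \<le> w + s" using False neg by auto
      ultimately obtain x where "w + s < x" "x < w"
        "stein_sol z w - stein_sol z (w + s) = (w - (w + s)) * stein_der z x"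
        by (rule stein_sol_mvt)
      then show ?thesis using False by (intro exI[of _ x]) auto
    qed
    then obtain x where x: "\<bar>x - w\<bar> \<le> \<bar>s\<bar>" "x \<le> z \<longleftrightarrow> w \<le> z"
      "stein_sol z (w + s) - stein_sol z w = s * stein_der z x" by blast
    have "stein_der z x - stein_der z w = x * (stein_sol z x - stein_sol z w) + (x - w) * stein_sol z w"
      unfolding stein_der_def using x(2) by (simp add: algebra_simps)
    also have "\<bar>\<dots>\<bar> \<le> \<bar>x\<bar> * \<bar>stein_sol z x - stein_sol z w\<bar> + \<bar>x - w\<bar> * \<bar>stein_sol z w\<bar>"
      by (metis abs_mult abs_triangle_ineq)
    also have "\<dots> \<le> (\<bar>w\<bar> + \<bar>s\<bar>) * (2 * \<bar>s\<bar>) + \<bar>s\<bar> * 6"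
      using x(1) abs_stein_sol[of z w] stein_sol_lipschitz[of z w "x - w"]
      by (intro add_mono mult_mono) auto
    finally have "\<bar>stein_der z x - stein_der z w\<bar> \<le> \<bar>s\<bar> * (6 + 2 * (\<bar>w\<bar> + \<bar>s\<bar>))"
      by (simp add: algebra_simps)
    then have "\<bar>s\<bar> * \<bar>stein_der z x - stein_der z w\<bar> \<le> \<bar>s\<bar> * (\<bar>s\<bar> * (6 + 2 * (\<bar>w\<bar> + \<bar>s\<bar>)))"
      by (intro mult_left_mono) auto
    moreover have "stein_sol z (w + s) - stein_sol z w - s * stein_der z w
        = s * (stein_der z x - stein_der z w)"
      unfolding x(3) by (simp add: algebra_simps)
    ultimately show ?thesis using False by (simp add: abs_mult power2_eq_square flip: mult.assoc)
  qed simp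
qed

subsection \<open>Stein's method for bounded jumps\<close>

definition avg :: "'a set \<Rightarrow> ('a \<Rightarrow> real) \<Rightarrow> real" where
  "avg A F = (\<Sum>x\<in>A. F x) / real (card A)"

lemma avg_add: "avg A (\<lambda>x. F x + G x) = avg A F + avg A G"
  by (simp add: avg_def sum.distrib add_divide_distrib)

lemma avg_diff: "avg A (\<lambda>x. F x - G x) = avg A F - avg A G"
  by (simp add: avg_def sum_subtractf diff_divide_distrib)

lemma avg_cmult: "avg A (\<lambda>x. c * F x) = c * avg A F"
  by (simp add: avg_def flip: sum_distrib_left)

lemma avg_sum: "avg A (\<lambda>x. \<Sum>i\<in>I. F i x) = (\<Sum>i\<in>I. avg A (F i))"
  unfolding avg_def by (subst sum.swap) (simp add: sum_divide_distrib)

lemma avg_const: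
  assumes "finite A" "A \<noteq> {}"
  shows "avg A (\<lambda>x. c) = c"
  using assms by (simp add: avg_def)

lemma avg_cong: "(\<And>x. x \<in> A \<Longrightarrow> F x = G x) \<Longrightarrow> avg A F = avg A G"
  by (simp add: avg_def)

lemma avg_mono: "(\<And>x. x \<in> A \<Longrightarrow> F x \<le> G x) \<Longrightarrow> avg A F \<le> avg A G"
  unfolding avg_def by (intro divide_right_mono sum_mono) auto

lemma avg_nonneg: "(\<And>x. x \<in> A \<Longrightarrow> 0 \<le> F x) \<Longrightarrow> 0 \<le> avg A F"
  unfolding avg_def by (intro divide_nonneg_nonneg sum_nonneg) auto

lemma abs_avg_le: "\<bar>avg A F\<bar> \<le> avg A (\<lambda>x. \<bar>F x\<bar>)"
  unfolding avg_def by (simp add: divide_right_mono)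

text \<open>Nonnegativity of the variance of \<open>\<bar>F\<bar>\<close>; this is the passage from
  second moments to mean absolute errors.\<close>

lemma avg_abs_le_sqrt: "avg A (\<lambda>x. \<bar>F x\<bar>) \<le> sqrt (avg A (\<lambda>x. (F x)\<^sup>2))"
proof (cases "card A = 0")
  case False
  define m where "m = avg A (\<lambda>x. \<bar>F x\<bar>)"
  have fin: "finite A" "A \<noteq> {}" using False by (auto intro: card_ge_0_finite)
  have "0 \<le> avg A (\<lambda>x. (\<bar>F x\<bar> - m)\<^sup>2)" by (intro avg_nonneg) simp
  also have "\<dots> = avg A (\<lambda>x. (F x)\<^sup>2 - 2 * m * \<bar>F x\<bar> + m\<^sup>2)"
    by (intro avg_cong) (simp add: power2_eq_square algebra_simps)
  also have "\<dots> = avg A (\<lambda>x. (F x)\<^sup>2) - 2 * m * m + m\<^sup>2"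
    using fin by (simp add: avg_add avg_diff avg_cmult avg_const m_def)
  finally have "m\<^sup>2 \<le> avg A (\<lambda>x. (F x)\<^sup>2)" by (simp add: power2_eq_square)
  then show ?thesis using real_le_rsqrt unfolding m_def by blast
qed (simp add: avg_def)

text \<open>Abstraction from trees: \<open>i\<close> stands for a swap, \<open>D\<close> for the
  resulting jump of \<open>W\<close>, \<open>q\<close> for the defect from an exact
  exchangeable-pair relation, and \<open>\<rho>\<close> for an error in the centring. The weighted
  sum of squared jumps acts as the variance and has to be near 1 only in mean.\<close>

locale bounded_stein_pair =
  fixes \<Omega> :: "'a set" and I :: "'i set" and W :: "'a \<Rightarrow> real" and D q :: "'a \<Rightarrow> 'i \<Rightarrow> real"
    and c \<rho> \<delta> \<beta> \<epsilon> K :: real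
  assumes fin: "finite \<Omega>" "\<Omega> \<noteq> {}"
    and c: "c \<ge> 0" and \<delta>: "\<delta> \<ge> 0"
    and stein_identity: "\<And>f::real \<Rightarrow> real. avg \<Omega> (\<lambda>T. W T * f (W T)) =
      avg \<Omega> (\<lambda>T. \<Sum>i\<in>I. c * (D T i - q T i) * (f (W T + D T i) - f (W T))) + \<rho> * avg \<Omega> (\<lambda>T. f (W T))"
    and D_le: "\<And>T i. T \<in> \<Omega> \<Longrightarrow> i \<in> I \<Longrightarrow> \<bar>D T i\<bar> \<le> \<delta>"
    and q_le: "avg \<Omega> (\<lambda>T. \<Sum>i\<in>I. c * \<bar>q T i\<bar>) \<le> \<beta>"
    and variance_le: "avg \<Omega> (\<lambda>T. \<bar>1 - (\<Sum>i\<in>I. c * (D T i)\<^sup>2)\<bar>) \<le> \<epsilon>"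
    and K: "c * real (card I) * \<delta>\<^sup>2 \<le> K"
begin

definition M :: real where "M = K + \<delta> * \<beta> + \<bar>\<rho>\<bar> + 1"

lemma K_nonneg: "0 \<le> K"
  using K c by (smt (verit) mult_nonneg_nonneg of_nat_0_le_iff zero_le_power2)

lemma \<beta>_nonneg: "0 \<le> \<beta>"
  by (rule order.trans[OF avg_nonneg q_le]) (auto intro!: sum_nonneg mult_nonneg_nonneg c)

text \<open>With the identity as test function, the second moment is at most
  \<open>K + \<delta> * \<beta>\<close> plus \<open>\<bar>\<rho>\<bar>\<close> times the first
  absolute moment \<open>m\<close>. If \<open>m\<close> exceeded \<open>M\<close>, then
  \<open>m \<ge> 1\<close>, and this bound would fall below \<open>m * m\<close>. The summand 1 in
  \<open>M\<close> secures \<open>m \<ge> 1\<close>.\<close>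

lemma W_le: "avg \<Omega> (\<lambda>T. \<bar>W T\<bar>) \<le> M"
proof (rule ccontr)
  define m where "m = avg \<Omega> (\<lambda>T. \<bar>W T\<bar>)"
  assume "\<not> ?thesis"
  then have m: "M < m" by (simp add: m_def)
  have "m\<^sup>2 \<le> avg \<Omega> (\<lambda>T. (W T)\<^sup>2)"
  proof -
    have nn: "0 \<le> avg \<Omega> (\<lambda>T. (W T)\<^sup>2)" by (intro avg_nonneg) simp
    have "m\<^sup>2 \<le> (sqrt (avg \<Omega> (\<lambda>T. (W T)\<^sup>2)))\<^sup>2"
      unfolding m_def by (intro power_mono avg_abs_le_sqrt avg_nonneg) simp
    with nn show ?thesis by simp
  qed
  also have "\<dots> = avg \<Omega> (\<lambda>T. \<Sum>i\<in>I. c * (D T i - q T i) * D T i) + \<rho> * avg \<Omega> W"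
    using stein_identity[of "\<lambda>w. w"] by (simp add: power2_eq_square)
  also have "\<dots> \<le> (K + \<delta> * \<beta>) + \<bar>\<rho>\<bar> * m"
  proof (rule add_mono)
    have "avg \<Omega> (\<lambda>T. \<Sum>i\<in>I. c * (D T i - q T i) * D T i)
        \<le> avg \<Omega> (\<lambda>T. K + \<delta> * (\<Sum>i\<in>I. c * \<bar>q T i\<bar>))"
    proof (rule avg_mono)
      fix T assume T: "T \<in> \<Omega>"
      have "(\<Sum>i\<in>I. c * (D T i - q T i) * D T i) \<le> (\<Sum>i\<in>I. c * \<delta>\<^sup>2 + \<delta> * (c * \<bar>q T i\<bar>))"
      proof (rule sum_mono)
        fix i assume i: "i \<in> I"
        have "(D T i)\<^sup>2 \<le> \<delta>\<^sup>2" using power_mono[OF D_le[OF T i], of 2] by simp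
        moreover have "- (q T i * D T i) \<le> \<bar>q T i\<bar> * \<bar>D T i\<bar>" by (metis abs_ge_minus_self abs_mult)
        moreover have "\<bar>q T i\<bar> * \<bar>D T i\<bar> \<le> \<bar>q T i\<bar> * \<delta>" by (rule mult_left_mono[OF D_le[OF T i]]) simp
        ultimately have "(D T i - q T i) * D T i \<le> \<delta>\<^sup>2 + \<delta> * \<bar>q T i\<bar>"
          by (simp add: power2_eq_square algebra_simps)
        from mult_left_mono[OF this c]
        show "c * (D T i - q T i) * D T i \<le> c * \<delta>\<^sup>2 + \<delta> * (c * \<bar>q T i\<bar>)"
          by (simp add: algebra_simps)
      qed
      also have "\<dots> \<le> K + \<delta> * (\<Sum>i\<in>I. c * \<bar>q T i\<bar>)"
        using K by (simp add: sum.distrib sum_distrib_left algebra_simps)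
      finally show "(\<Sum>i\<in>I. c * (D T i - q T i) * D T i) \<le> K + \<delta> * (\<Sum>i\<in>I. c * \<bar>q T i\<bar>)" .
    qed
    also have "\<dots> \<le> K + \<delta> * \<beta>"
      unfolding avg_add avg_cmult using fin q_le \<delta> by (simp add: avg_const mult_left_mono)
    finally show "avg \<Omega> (\<lambda>T. \<Sum>i\<in>I. c * (D T i - q T i) * D T i) \<le> K + \<delta> * \<beta>" .
    have "\<bar>avg \<Omega> W\<bar> \<le> m" unfolding m_def by (rule abs_avg_le)
    then have "\<bar>\<rho> * avg \<Omega> W\<bar> \<le> \<bar>\<rho>\<bar> * m" unfolding abs_mult by (intro mult_left_mono) auto
    then show "\<rho> * avg \<Omega> W \<le> \<bar>\<rho>\<bar> * m" by linarith
  qed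
  finally have "m * m \<le> (K + \<delta> * \<beta>) + \<bar>\<rho>\<bar> * m" by (simp add: power2_eq_square)
  moreover have pos: "K + \<delta> * \<beta> \<ge> 0"
    by (intro add_nonneg_nonneg mult_nonneg_nonneg K_nonneg \<beta>_nonneg \<delta>)
  moreover have m1: "1 \<le> m" using m pos by (simp add: M_def)
  moreover have "(K + \<delta> * \<beta>) * 1 \<le> (K + \<delta> * \<beta>) * m"
    using pos m1 by (intro mult_left_mono)
  moreover have "M * m < m * m" using m m1 by (intro mult_strict_right_mono) auto
  ultimately show False unfolding M_def by (simp add: distrib_right)
qed

text \<open>The test function is monotone, so no jump contributes negatively to the main sum, while
  jumps starting in the interval contribute their full squares, which total about 1. The other side
  of the identity is at most \<open>h\<close> times a first moment.\<close>

lemma concentration: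
  assumes "a \<le> b"
  shows "avg \<Omega> (\<lambda>T. of_bool (a \<le> W T \<and> W T \<le> b)) \<le> (M + \<bar>\<rho>\<bar>) * ((b - a) / 2 + \<delta>) + \<delta> * \<beta> + \<epsilon>"
proof -
  \<comment> \<open>Half the length of the interval enlarged by \<open>\<delta>\<close> at both
    ends: a jump from inside stays in the part where \<open>f\<close> has slope 1.\<close>
  define h where "h = (b - a) / 2 + \<delta>"
  define f where "f = (\<lambda>w::real. max (- h) (min h (w - (a + b) / 2)))"
  have h: "h \<ge> 0" using assms \<delta> by (simp add: h_def)
  have f_le: "\<bar>f w\<bar> \<le> h" for w using h by (auto simp: f_def)
  have f_lip: "\<bar>f (w + d) - f w\<bar> \<le> \<bar>d\<bar>" for w d by (auto simp: f_def)
  have f_mono: "d * (f (w + d) - f w) \<ge> 0" for w d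
    by (cases "d \<ge> 0") (auto simp: f_def intro!: mult_nonneg_nonneg mult_nonpos_nonpos)
  have f_lin: "f (w + d) - f w = d" if "a \<le> w \<and> w \<le> b" "\<bar>d\<bar> \<le> \<delta>" for w d
    using that by (auto simp: f_def h_def field_simps)
  let ?S = "\<lambda>T. \<Sum>i\<in>I. c * (D T i - q T i) * (f (W T + D T i) - f (W T))"
  have key: "of_bool (a \<le> W T \<and> W T \<le> b) - \<bar>1 - (\<Sum>i\<in>I. c * (D T i)\<^sup>2)\<bar>
      - \<delta> * (\<Sum>i\<in>I. c * \<bar>q T i\<bar>) \<le> ?S T" if T: "T \<in> \<Omega>" for T
  proof -
    let ?in = "a \<le> W T \<and> W T \<le> b"
    have "of_bool ?in * (c * (D T i)\<^sup>2) - \<delta> * (c * \<bar>q T i\<bar>)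
        \<le> c * (D T i - q T i) * (f (W T + D T i) - f (W T))" if i: "i \<in> I" for i
    proof -
      let ?\<Delta> = "f (W T + D T i) - f (W T)"
      have 1: "of_bool ?in * (D T i)\<^sup>2 \<le> D T i * ?\<Delta>"
        using f_lin[of "W T" "D T i"] D_le[OF T i] f_mono[of "D T i" "W T"]
        by (auto simp: power2_eq_square)
      have "q T i * ?\<Delta> \<le> \<bar>q T i\<bar> * \<bar>?\<Delta>\<bar>" by (metis abs_ge_self abs_mult)
      also have "\<dots> \<le> \<bar>q T i\<bar> * \<delta>"
        using f_lip[of "W T" "D T i"] D_le[OF T i] by (intro mult_left_mono) auto
      finally have "of_bool ?in * (D T i)\<^sup>2 - \<delta> * \<bar>q T i\<bar> \<le> (D T i - q T i) * ?\<Delta>"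
        using 1 by (simp add: algebra_simps)
      from mult_left_mono[OF this c] show ?thesis by (simp add: algebra_simps)
    qed
    then have "(\<Sum>i\<in>I. of_bool ?in * (c * (D T i)\<^sup>2) - \<delta> * (c * \<bar>q T i\<bar>)) \<le> ?S T"
      by (rule sum_mono)
    also have "(\<Sum>i\<in>I. of_bool ?in * (c * (D T i)\<^sup>2) - \<delta> * (c * \<bar>q T i\<bar>))
        = of_bool ?in * (\<Sum>i\<in>I. c * (D T i)\<^sup>2) - \<delta> * (\<Sum>i\<in>I. c * \<bar>q T i\<bar>)"
      by (simp add: sum_subtractf sum_distrib_left)
    finally show ?thesis by (cases ?in) (simp_all, linarith+)
  qed
  have "avg \<Omega> (\<lambda>T. of_bool (a \<le> W T \<and> W T \<le> b)) - \<epsilon> - \<delta> * \<beta>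
      \<le> avg \<Omega> (\<lambda>T. of_bool (a \<le> W T \<and> W T \<le> b) - \<bar>1 - (\<Sum>i\<in>I. c * (D T i)\<^sup>2)\<bar>
        - \<delta> * (\<Sum>i\<in>I. c * \<bar>q T i\<bar>))"
    unfolding avg_diff avg_cmult using variance_le mult_left_mono[OF q_le \<delta>] by linarith
  also have "\<dots> \<le> avg \<Omega> ?S" using key by (rule avg_mono)
  also have "\<dots> = avg \<Omega> (\<lambda>T. W T * f (W T)) - \<rho> * avg \<Omega> (\<lambda>T. f (W T))"
    using stein_identity[of f] by simp
  also have "\<dots> \<le> h * M + \<bar>\<rho>\<bar> * h"
  proof -
    have "avg \<Omega> (\<lambda>T. W T * f (W T)) \<le> avg \<Omega> (\<lambda>T. h * \<bar>W T\<bar>)"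
    proof (rule avg_mono)
      fix T
      have "W T * f (W T) \<le> \<bar>W T\<bar> * \<bar>f (W T)\<bar>" by (metis abs_ge_self abs_mult)
      also have "\<dots> \<le> \<bar>W T\<bar> * h" using f_le by (intro mult_left_mono) auto
      finally show "W T * f (W T) \<le> h * \<bar>W T\<bar>" by (simp add: mult.commute)
    qed
    also have "\<dots> \<le> h * M" unfolding avg_cmult using h W_le by (intro mult_left_mono) auto
    finally have 1: "avg \<Omega> (\<lambda>T. W T * f (W T)) \<le> h * M" .
    have "\<bar>avg \<Omega> (\<lambda>T. f (W T))\<bar> \<le> avg \<Omega> (\<lambda>T. \<bar>f (W T)\<bar>)" by (rule abs_avg_le)
    also have "\<dots> \<le> avg \<Omega> (\<lambda>T. h)" using f_le by (intro avg_mono) auto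
    finally have "\<bar>\<rho> * avg \<Omega> (\<lambda>T. f (W T))\<bar> \<le> \<bar>\<rho>\<bar> * h"
      unfolding abs_mult using fin by (intro mult_left_mono) (auto simp: avg_const)
    with 1 show ?thesis by linarith
  qed
  finally show ?thesis unfolding h_def[symmetric] by (simp add: algebra_simps)
qed

text \<open>Stein's equation turns the left side into the mean of f'(W) - W f(W), and
  \<open>?S\<close> approximates f'(W) times the sum of squared jumps. The terms of the bound come,
  in order, from the distance of that sum from 1, the second-order error together with the kink, the
  defect \<open>q\<close>, and the shift \<open>\<rho>\<close>.\<close>

lemma kolmogorov_bound:
  "\<bar>avg \<Omega> (\<lambda>T. of_bool (W T \<le> z)) - Phi z\<bar> \<le>
     2 * \<epsilon> + K * (\<delta> * (6 + 2 * (M + \<delta>)) + 4 * ((M + \<bar>\<rho>\<bar>) * (2 * \<delta>) + \<delta> * \<beta> + \<epsilon>))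
     + 2 * \<delta> * \<beta> + 6 * \<bar>\<rho>\<bar>"
proof -
  let ?f = "stein_sol z" and ?f' = "stein_der z"
  define P where "P = avg \<Omega> (\<lambda>T. of_bool (\<bar>W T - z\<bar> \<le> \<delta>))"
  let ?V = "\<lambda>T. \<Sum>i\<in>I. c * (D T i)\<^sup>2"
  let ?Q = "\<lambda>T. \<Sum>i\<in>I. c * \<bar>q T i\<bar>"
  let ?S = "\<lambda>T. \<Sum>i\<in>I. c * (D T i - q T i) * (?f (W T + D T i) - ?f (W T))"
  let ?B = "\<lambda>T. \<delta> * (6 + 2 * (\<bar>W T\<bar> + \<delta>)) + 4 * of_bool (\<bar>W T - z\<bar> \<le> \<delta>)"
  have pw: "\<bar>?f' (W T) - ?S T\<bar> \<le> 2 * \<bar>1 - ?V T\<bar> + K * ?B T + 2 * \<delta> * ?Q T" if T: "T \<in> \<Omega>" for T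
  proof -
    have summand: "\<bar>c * (D T i)\<^sup>2 * ?f' (W T) - c * (D T i - q T i) * (?f (W T + D T i) - ?f (W T))\<bar>
        \<le> c * \<delta>\<^sup>2 * ?B T + 2 * \<delta> * (c * \<bar>q T i\<bar>)" if i: "i \<in> I" for i
    proof -
      let ?d = "D T i" and ?\<Delta> = "?f (W T + D T i) - ?f (W T)"
      have d: "\<bar>?d\<bar> \<le> \<delta>" using D_le[OF T i] .
      have d2: "?d\<^sup>2 \<le> \<bar>?d\<bar> * \<delta>"
        using mult_left_mono[OF d, of "\<bar>?d\<bar>"] by (simp add: power2_eq_square)
      have "\<bar>?\<Delta> - ?d * ?f' (W T)\<bar> \<le> ?d\<^sup>2 * (6 + 2 * (\<bar>W T\<bar> + \<bar>?d\<bar>)) + 4 * \<bar>?d\<bar> * of_bool (\<bar>W T - z\<bar> \<le> \<bar>?d\<bar>)"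
        by (rule stein_sol_increment)
      also have "\<dots> \<le> \<bar>?d\<bar> * \<delta> * (6 + 2 * (\<bar>W T\<bar> + \<delta>)) + 4 * \<bar>?d\<bar> * of_bool (\<bar>W T - z\<bar> \<le> \<delta>)"
        using d d2 \<delta> by (intro add_mono mult_mono mult_left_mono) auto
      also have "\<dots> = \<bar>?d\<bar> * ?B T" by (simp add: algebra_simps)
      also have "\<dots> \<le> \<delta> * ?B T" using d \<delta> by (intro mult_right_mono) auto
      finally have 1: "\<bar>?\<Delta> - ?d * ?f' (W T)\<bar> \<le> \<delta> * ?B T" .
      have "\<bar>?d * (?\<Delta> - ?d * ?f' (W T))\<bar> \<le> \<delta> * (\<delta> * ?B T)"
        unfolding abs_mult using d 1 \<delta> by (intro mult_mono) auto
      moreover have "\<bar>q T i * ?\<Delta>\<bar> \<le> \<bar>q T i\<bar> * (2 * \<delta>)"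
        unfolding abs_mult using stein_sol_lipschitz[of z "W T" ?d] d by (intro mult_left_mono) auto
      ultimately have "\<bar>?d\<^sup>2 * ?f' (W T) - (?d - q T i) * ?\<Delta>\<bar> \<le> \<delta> * (\<delta> * ?B T) + \<bar>q T i\<bar> * (2 * \<delta>)"
        by (auto simp: power2_eq_square algebra_simps abs_le_iff)
      from mult_left_mono[OF this c]
      have "\<bar>c * (?d\<^sup>2 * ?f' (W T) - (?d - q T i) * ?\<Delta>)\<bar> \<le> c * (\<delta> * (\<delta> * ?B T) + \<bar>q T i\<bar> * (2 * \<delta>))"
        using c by (simp add: abs_mult)
      then show ?thesis by (simp only: power2_eq_square algebra_simps)
    qed
    have split: "?f' (W T) - ?S T = ?f' (W T) * (1 - ?V T) +
        (\<Sum>i\<in>I. c * (D T i)\<^sup>2 * ?f' (W T) - c * (D T i - q T i) * (?f (W T + D T i) - ?f (W T)))"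
      by (simp add: sum_subtractf sum_distrib_right right_diff_distrib mult.commute[of "?f' (W T)"])
    have "\<bar>?f' (W T) - ?S T\<bar> \<le> 2 * \<bar>1 - ?V T\<bar> + (\<Sum>i\<in>I. c * \<delta>\<^sup>2 * ?B T + 2 * \<delta> * (c * \<bar>q T i\<bar>))"
      unfolding split
    proof (rule order.trans[OF abs_triangle_ineq add_mono])
      show "\<bar>?f' (W T) * (1 - ?V T)\<bar> \<le> 2 * \<bar>1 - ?V T\<bar>"
        unfolding abs_mult using abs_stein_der by (intro mult_right_mono) auto
      show "\<bar>\<Sum>i\<in>I. c * (D T i)\<^sup>2 * ?f' (W T) - c * (D T i - q T i) * (?f (W T + D T i) - ?f (W T))\<bar>
          \<le> (\<Sum>i\<in>I. c * \<delta>\<^sup>2 * ?B T + 2 * \<delta> * (c * \<bar>q T i\<bar>))"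
        by (rule order.trans[OF sum_abs sum_mono[OF summand]])
    qed
    also have "(\<Sum>i\<in>I. c * \<delta>\<^sup>2 * ?B T + 2 * \<delta> * (c * \<bar>q T i\<bar>))
        = (c * real (card I) * \<delta>\<^sup>2) * ?B T + 2 * \<delta> * ?Q T"
    proof -
      have aux: "(\<Sum>i\<in>I. u + v * g i) = real (card I) * u + v * (\<Sum>i\<in>I. g i)" for u v :: real and g
        by (simp add: sum.distrib sum_distrib_left)
      show ?thesis unfolding aux by (simp only: mult_ac)
    qed
    also have "(c * real (card I) * \<delta>\<^sup>2) * ?B T \<le> K * ?B T"
      using K \<delta> by (intro mult_right_mono) auto
    finally show ?thesis by linarith
  qed
  have "avg \<Omega> (\<lambda>T. of_bool (W T \<le> z)) - Phi z
      = avg \<Omega> (\<lambda>T. of_bool (W T \<le> z) - Phi z)"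
    using fin by (simp add: avg_diff avg_const)
  also have "\<dots> = avg \<Omega> (\<lambda>T. ?f' (W T) - W T * ?f (W T))"
    by (intro avg_cong) (simp add: stein_der_def)
  also have "\<dots> = avg \<Omega> (\<lambda>T. ?f' (W T) - ?S T) - \<rho> * avg \<Omega> (\<lambda>T. ?f (W T))"
    unfolding avg_diff using stein_identity[of ?f] by simp
  finally have split: "avg \<Omega> (\<lambda>T. of_bool (W T \<le> z)) - Phi z
      = avg \<Omega> (\<lambda>T. ?f' (W T) - ?S T) - \<rho> * avg \<Omega> (\<lambda>T. ?f (W T))" .
  have "\<bar>avg \<Omega> (\<lambda>T. of_bool (W T \<le> z)) - Phi z\<bar> \<le> avg \<Omega> (\<lambda>T. 2 * \<bar>1 - ?V T\<bar> + K * ?B T + 2 * \<delta> * ?Q T) + 6 * \<bar>\<rho>\<bar>"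
  proof -
    have "\<bar>avg \<Omega> (\<lambda>T. ?f' (W T) - ?S T)\<bar> \<le> avg \<Omega> (\<lambda>T. \<bar>?f' (W T) - ?S T\<bar>)"
      by (rule abs_avg_le)
    also have "\<dots> \<le> avg \<Omega> (\<lambda>T. 2 * \<bar>1 - ?V T\<bar> + K * ?B T + 2 * \<delta> * ?Q T)"
      using pw by (rule avg_mono)
    finally have 1: "\<bar>avg \<Omega> (\<lambda>T. ?f' (W T) - ?S T)\<bar>
      \<le> avg \<Omega> (\<lambda>T. 2 * \<bar>1 - ?V T\<bar> + K * ?B T + 2 * \<delta> * ?Q T)" .
    have "\<bar>avg \<Omega> (\<lambda>T. ?f (W T))\<bar> \<le> avg \<Omega> (\<lambda>T. \<bar>?f (W T)\<bar>)" by (rule abs_avg_le)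
    also have "\<dots> \<le> avg \<Omega> (\<lambda>T. 6)" using abs_stein_sol by (intro avg_mono) auto
    finally have "\<bar>\<rho> * avg \<Omega> (\<lambda>T. ?f (W T))\<bar> \<le> \<bar>\<rho>\<bar> * 6"
      unfolding abs_mult using fin by (intro mult_left_mono) (auto simp: avg_const)
    with 1 show ?thesis unfolding split by linarith
  qed
  also have "avg \<Omega> (\<lambda>T. 2 * \<bar>1 - ?V T\<bar> + K * ?B T + 2 * \<delta> * ?Q T)
      = 2 * avg \<Omega> (\<lambda>T. \<bar>1 - ?V T\<bar>) + K * (\<delta> * (6 + 2 * (avg \<Omega> (\<lambda>T. \<bar>W T\<bar>) + \<delta>)) + 4 * P)
        + 2 * \<delta> * avg \<Omega> ?Q"
    unfolding avg_add avg_cmult P_def using fin by (simp add: avg_const)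
  also have "\<dots> \<le> 2 * \<epsilon> + K * (\<delta> * (6 + 2 * (M + \<delta>)) + 4 * ((M + \<bar>\<rho>\<bar>) * (2 * \<delta>) + \<delta> * \<beta> + \<epsilon>))
     + 2 * \<delta> * \<beta>"
  proof -
    have "P = avg \<Omega> (\<lambda>T. of_bool (z - \<delta> \<le> W T \<and> W T \<le> z + \<delta>))"
      unfolding P_def by (intro avg_cong) (auto simp: abs_le_iff)
    \<comment> \<open>The window has half-width \<open>\<delta>\<close>, and
      \<open>concentration\<close> adds another \<open>\<delta>\<close>.\<close>
    also have "\<dots> \<le> (M + \<bar>\<rho>\<bar>) * ((z + \<delta> - (z - \<delta>)) / 2 + \<delta>) + \<delta> * \<beta> + \<epsilon>"
      using \<delta> by (intro concentration) simp
    finally have "P \<le> (M + \<bar>\<rho>\<bar>) * (2 * \<delta>) + \<delta> * \<beta> + \<epsilon>" by simp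
    then show ?thesis
      using variance_le W_le q_le K_nonneg \<delta> by (intro add_mono mult_left_mono) auto
  qed
  finally show ?thesis by simp
qed

end

subsection \<open>Power sums over chord lengths\<close>

text \<open>To be used with \<open>m = n - 2\<close> and with \<open>j\<close> one less than the
  length of a chord.\<close>

lemma sum_chord_lengths:
  "(\<Sum>j<N. real j * (m - real j))
    = m * (real N * (real N - 1) / 2) - (real N - 1) * real N * (2 * real N - 1) / 6"
  by (induction N) (simp_all add: field_simps power2_eq_square)

lemma sum_chord_lengths_square:
  "(\<Sum>j<N. (real j * (m - real j))\<^sup>2)
    = m\<^sup>2 * ((real N - 1) * real N * (2 * real N - 1) / 6) - 2 * m * (real N * (real N - 1) / 2)\<^sup>2
      + real N * (real N - 1) * (2 * real N - 1) * (3 * (real N)\<^sup>2 - 3 * real N - 1) / 30"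
proof (induction N)
  case (Suc N)
  then show ?case
    by (simp add: field_simps power2_eq_square)
qed simp

subsection \<open>The swap identity for uniform random trees\<close>

text \<open>Minima and maxima make the relation independent of the order of end points; strictness
  excludes chords with a common end.\<close>

definition crosses :: "nat \<Rightarrow> nat \<Rightarrow> nat \<Rightarrow> nat \<Rightarrow> bool" where
  "crosses v x y z \<longleftrightarrow>
     min v x < min y z \<and> min y z < max v x \<and> max v x < max y z \<or>
     min y z < min v x \<and> min v x < max y z \<and> max y z < max v x"

lemma crosses_commute: "crosses v x y z = crosses x v y z" "crosses v x y z = crosses v x z y"
    "crosses v x y z = crosses y z v x"
  by (auto simp: crosses_def min.commute max.commute)

lemma not_crosses_shared: "\<not> crosses v x v y"
  by (auto simp: crosses_def min_def max_def split: if_splits)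

definition cross_ind :: "nat \<Rightarrow> nat \<Rightarrow> nat \<Rightarrow> nat \<Rightarrow> real" where
  "cross_ind v x y z = of_bool (crosses v x y z)"

lemma cross_ind_commute: "cross_ind v x y z = cross_ind x v y z"
    "cross_ind v x y z = cross_ind v x z y"
    "cross_ind v x y z = cross_ind y z v x"
  unfolding cross_ind_def
  using crosses_commute(1)[of v x y z] crosses_commute(2)[of v x y z] crosses_commute(3)[of v x y z]
  by simp_all

definition edge_ind :: "nat set set \<Rightarrow> nat \<Rightarrow> nat \<Rightarrow> real" where
  "edge_ind T a b = of_bool ({a, b} \<in> T)"

lemma edge_ind_commute: "edge_ind T a b = edge_ind T b a"
  by (simp add: edge_ind_def insert_commute)

definition symmetric :: "(nat \<Rightarrow> nat \<Rightarrow> real) \<Rightarrow> bool" where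
  "symmetric w \<longleftrightarrow> (\<forall>a b. w a b = w b a)"

lemma symmetricD: "symmetric w \<Longrightarrow> w a b = w b a"
  by (simp add: symmetric_def)

locale convex_trees =
  fixes n :: nat
  assumes n: "4 \<le> n"
begin

abbreviation V :: "nat set" where "V \<equiv> {1..n}"
abbreviation trees :: "nat set set set" where "trees \<equiv> labelled_trees n"
abbreviation E :: "(nat set set \<Rightarrow> real) \<Rightarrow> real" where "E \<equiv> avg trees"

definition pairs :: "(nat \<times> nat) set" where
  "pairs = Sigma V (\<lambda>v. V - {v})"

lemma finite_pairs: "finite pairs"
  by (simp add: pairs_def)

lemma card_pairs: "real (card pairs) = real n * (real n - 1)"
  using n by (simp add: pairs_def of_nat_diff)

lemma card_pairs_le: "real (card pairs) \<le> (real n)\<^sup>2"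
  unfolding card_pairs power2_eq_square by (intro mult_left_mono) auto

lemma mem_pairs: "(v, x) \<in> pairs \<longleftrightarrow> v \<in> V \<and> x \<in> V \<and> v \<noteq> x"
  by (auto simp: pairs_def)

lemma finite_trees: "finite trees" and trees_nonempty: "trees \<noteq> {}"
  using finite_labelled_trees labelled_trees_nonempty n by auto

lemma E_const: "E (\<lambda>T. c) = c"
  using finite_trees trees_nonempty by (rule avg_const)

lemma mem_trees_iff: "T \<in> trees \<longleftrightarrow> is_tree V T"
  by (simp add: labelled_trees_def)

lemma sum_pairs_nested: "(\<Sum>(v, x)\<in>pairs. f v x) = (\<Sum>v\<in>V. \<Sum>x\<in>V - {v}. f v x)"
  unfolding pairs_def by (simp add: sum.Sigma)

lemma sum_pairs_commute: "(\<Sum>(v, x)\<in>pairs. f v x) = (\<Sum>(v, x)\<in>pairs. f x v)"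
  by (rule sum.reindex_bij_witness[where i = "\<lambda>(v, x). (x, v)" and j = "\<lambda>(v, x). (x, v)"])
    (auto simp: mem_pairs)

lemma sum_pairs_cong: "(\<And>v x. (v, x) \<in> pairs \<Longrightarrow> f v x = g v x) \<Longrightarrow>
    (\<Sum>(v, x)\<in>pairs. f v x) = (\<Sum>(v, x)\<in>pairs. g v x)"
  by (rule sum.cong) auto

lemma sum_pairs_mono: "(\<And>v x. (v, x) \<in> pairs \<Longrightarrow> f v x \<le> g v x) \<Longrightarrow>
    (\<Sum>(v, x)\<in>pairs. f v x) \<le> (\<Sum>(v, x)\<in>pairs. g v x :: real)"
  by (rule sum_mono) auto

lemma sum_pairs_add: "(\<Sum>(v, x)\<in>pairs. f v x + g v x) = (\<Sum>(v, x)\<in>pairs. f v x) + (\<Sum>(v, x)\<in>pairs. g v x :: real)"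
  by (simp add: case_prod_unfold sum.distrib)

lemma sum_pairs_diff: "(\<Sum>(v, x)\<in>pairs. f v x - g v x) = (\<Sum>(v, x)\<in>pairs. f v x) - (\<Sum>(v, x)\<in>pairs. g v x :: real)"
  by (simp add: case_prod_unfold sum_subtractf)

lemma sum_pairs_cmult: "(\<Sum>(v, x)\<in>pairs. c * f v x) = c * (\<Sum>(v, x)\<in>pairs. f v x :: real)"
  by (simp add: case_prod_unfold sum_distrib_left)

lemma sum_pairs_const: "(\<Sum>(v, x)\<in>pairs. c) = real n * (real n - 1) * c"
  by (simp add: case_prod_unfold card_pairs)

lemma sum_pairs_swap: "(\<Sum>(v, x)\<in>pairs. \<Sum>(y, z)\<in>pairs. f v x y z) = (\<Sum>(y, z)\<in>pairs. \<Sum>(v, x)\<in>pairs. f v x y z :: real)"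
  unfolding case_prod_unfold by (rule sum.swap)

lemma E_sum_pairs: "E (\<lambda>T. \<Sum>(v, x)\<in>pairs. F v x T) = (\<Sum>(v, x)\<in>pairs. E (F v x))"
  unfolding case_prod_unfold by (rule avg_sum)

section \<open>The swap as an involution preserving the uniform distribution\<close>

lemma toward_pairs:
  assumes "T \<in> trees" "(v, x) \<in> pairs"
  shows "(v, toward T v x) \<in> pairs" "{v, toward T v x} \<in> T"
  using toward_props[of V T v x] assms by (auto simp: mem_trees_iff mem_pairs)

lemma swap_trees: "T \<in> trees \<Longrightarrow> (v, x) \<in> pairs \<Longrightarrow> swap T v x \<in> trees"
  using swap_tree[of V T v x] by (auto simp: mem_trees_iff mem_pairs)

lemma swap_swap_trees: "T \<in> trees \<Longrightarrow> (v, x) \<in> pairs \<Longrightarrow> swap (swap T v x) v (toward T v x) = T"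
  using swap_swap[of V T v x] by (auto simp: mem_trees_iff mem_pairs)

lemma toward_swap_trees: "T \<in> trees \<Longrightarrow> (v, x) \<in> pairs \<Longrightarrow> toward (swap T v x) v (toward T v x) = x"
  using toward_swap[of V T v x] by (auto simp: mem_trees_iff mem_pairs)

text \<open>Exchangeability enters only here, as a reindexing of \<open>trees \<times> pairs\<close>
  by the involution; note that \<open>v\<close> stays fixed.\<close>

lemma E_swap:
  "E (\<lambda>T. \<Sum>(v, x)\<in>pairs. H T v x) = E (\<lambda>T. \<Sum>(v, x)\<in>pairs. H (swap T v x) v (toward T v x))"
proof -
  have "(\<Sum>T\<in>trees. \<Sum>(v, x)\<in>pairs. H T v x) = (\<Sum>(T, v, x)\<in>trees \<times> pairs. H T v x)"
    by (simp add: sum.cartesian_product case_prod_unfold)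
  also have "\<dots> = (\<Sum>(T, v, x)\<in>trees \<times> pairs. H (swap T v x) v (toward T v x))"
    by (rule sum.reindex_bij_witness[where
          i = "\<lambda>(T, v, x). (swap T v x, v, toward T v x)" and j = "\<lambda>(T, v, x). (swap T v x, v, toward T v x)"])
      (auto simp: swap_swap_trees toward_swap_trees swap_trees toward_pairs)
  also have "\<dots> = (\<Sum>T\<in>trees. \<Sum>(v, x)\<in>pairs. H (swap T v x) v (toward T v x))"
    by (simp add: sum.cartesian_product case_prod_unfold)
  finally show ?thesis by (simp add: avg_def)
qed

lemma E_swap_toward:
  "E (\<lambda>T. \<Sum>(v, x)\<in>pairs. h v (toward T v x) * F T) = E (\<lambda>T. \<Sum>(v, x)\<in>pairs. h v x * F (swap T v x))"
  by (subst E_swap) (auto intro!: avg_cong sum_pairs_cong simp: toward_swap_trees)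

text \<open>Sums over ordered pairs count every edge twice.\<close>

definition edge_sum :: "nat set set \<Rightarrow> (nat \<Rightarrow> nat \<Rightarrow> real) \<Rightarrow> real" where
  "edge_sum T w = (\<Sum>(a, b)\<in>pairs. w a b * edge_ind T a b)"

lemma edge_sum_add: "edge_sum T (\<lambda>a b. f a b + g a b) = edge_sum T f + edge_sum T g"
  by (simp add: edge_sum_def sum_pairs_add distrib_right)

lemma edge_sum_diff: "edge_sum T (\<lambda>a b. f a b - g a b) = edge_sum T f - edge_sum T g"
  by (simp add: edge_sum_def sum_pairs_diff left_diff_distrib)

lemma edge_sum_cong: "(\<And>a b. (a, b) \<in> pairs \<Longrightarrow> f a b = g a b) \<Longrightarrow> edge_sum T f = edge_sum T g"
  unfolding edge_sum_def by (rule sum_pairs_cong) simp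

lemma edge_sum_mono:
  assumes "\<And>a b. (a, b) \<in> pairs \<Longrightarrow> f a b \<le> g a b"
  shows "edge_sum T f \<le> edge_sum T g"
  unfolding edge_sum_def using assms by (intro sum_pairs_mono mult_right_mono) (auto simp: edge_ind_def)

text \<open>Grouping the \<open>x\<close> by first step weights each orientation of an edge by the
  size of one of its sides. Averaging the two orientations replaces this size by n/2, by
  \<open>toward_sides\<close>.\<close>

lemma sum_toward_eq_edge_sum:
  assumes T: "T \<in> trees" and w: "symmetric w"
  shows "(\<Sum>(v, x)\<in>pairs. w v (toward T v x)) = real n / 2 * edge_sum T w"
proof -
  define N where "N = (\<lambda>v u. real (card {x \<in> V - {v}. toward T v x = u}))"
  have "(\<Sum>(v, x)\<in>pairs. w v (toward T v x)) = (\<Sum>v\<in>V. \<Sum>x\<in>V - {v}. w v (toward T v x))"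
    by (rule sum_pairs_nested)
  also have "\<dots> = (\<Sum>v\<in>V. \<Sum>u\<in>V - {v}. w v u * N v u)"
  proof (rule sum.cong[OF refl])
    fix v assume v: "v \<in> V"
    have "toward T v ` (V - {v}) \<subseteq> V - {v}"
      using v toward_pairs(1)[OF T, of v] by (force simp: mem_pairs)
    then have "(\<Sum>x\<in>V - {v}. w v (toward T v x))
        = (\<Sum>u\<in>V - {v}. \<Sum>x\<in>{x \<in> V - {v}. toward T v x = u}. w v (toward T v x))"
      by (intro sum.group[symmetric]) auto
    also have "\<dots> = (\<Sum>u\<in>V - {v}. w v u * N v u)"
      by (intro sum.cong refl) (simp add: N_def)
    finally show "(\<Sum>x\<in>V - {v}. w v (toward T v x)) = (\<Sum>u\<in>V - {v}. w v u * N v u)" .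
  qed
  also have "\<dots> = (\<Sum>(v, u)\<in>pairs. w v u * N v u)"
    by (rule sum_pairs_nested[symmetric])
  finally have 1: "(\<Sum>(v, x)\<in>pairs. w v (toward T v x)) = (\<Sum>(v, u)\<in>pairs. w v u * N v u)" .
  also have 2: "\<dots> = (\<Sum>(v, u)\<in>pairs. w v u * N u v)"
    by (subst sum_pairs_commute) (simp add: symmetricD[OF w, of _ _])
  finally have "2 * (\<Sum>(v, x)\<in>pairs. w v (toward T v x)) = (\<Sum>(v, u)\<in>pairs. w v u * (N v u + N u v))"
    using 1 by (simp add: sum_pairs_add distrib_left)
  also have "\<dots> = (\<Sum>(v, u)\<in>pairs. real n * (w v u * edge_ind T v u))"
  proof (rule sum_pairs_cong)
    fix v u assume vu: "(v, u) \<in> pairs"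
    show "w v u * (N v u + N u v) = real n * (w v u * edge_ind T v u)"
    proof (cases "{v, u} \<in> T")
      case True
      have "card {x \<in> V - {v}. toward T v x = u} + card {x \<in> V - {u}. toward T u x = v} = n"
        using toward_sides[of V T v u] T True by (simp add: mem_trees_iff)
      then have "N v u + N u v = real n" unfolding N_def by (simp flip: of_nat_add)
      then show ?thesis using True by (simp add: edge_ind_def)
    next
      case False
      then have "{u, v} \<notin> T" by (simp add: insert_commute)
      then have "N v u = 0" "N u v = 0"
        using False vu toward_pairs(2)[OF T] unfolding N_def by (auto simp: mem_pairs)
      then show ?thesis using False by (simp add: edge_ind_def)
    qed
  qed
  finally show ?thesis by (simp add: edge_sum_def sum_pairs_cmult)
qed

lemma E_edge_sum_times:
  assumes w: "symmetric w"
  shows "real n / 2 * E (\<lambda>T. edge_sum T w * F T) = E (\<lambda>T. \<Sum>(v, x)\<in>pairs. w v x * F (swap T v x))"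
proof -
  have "real n / 2 * E (\<lambda>T. edge_sum T w * F T) = E (\<lambda>T. (\<Sum>(v, x)\<in>pairs. w v (toward T v x)) * F T)"
    unfolding avg_cmult[symmetric] by (intro avg_cong) (simp add: sum_toward_eq_edge_sum[OF _ w])
  also have "\<dots> = E (\<lambda>T. \<Sum>(v, x)\<in>pairs. w v (toward T v x) * F T)"
    by (simp add: sum_distrib_right case_prod_unfold)
  also have "\<dots> = E (\<lambda>T. \<Sum>(v, x)\<in>pairs. w v x * F (swap T v x))"
    by (rule E_swap_toward)
  finally show ?thesis .
qed

lemma E_edge_sum:
  assumes "symmetric w"
  shows "E (\<lambda>T. edge_sum T w) = 2 / real n * (\<Sum>(v, x)\<in>pairs. w v x)"
  using E_edge_sum_times[OF assms, of "\<lambda>T. 1"] n by (simp add: E_const field_simps)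

text \<open>That every tree has n - 1 edges drops out of the swap count for a constant weight, as
  there are n (n - 1) pairs; no induction on trees is involved.\<close>

lemma edge_sum_const:
  assumes "T \<in> trees"
  shows "edge_sum T (\<lambda>a b. c) = 2 * (real n - 1) * c"
proof -
  have "real n * (edge_sum T (\<lambda>a b. c) / 2) = real n * ((real n - 1) * c)"
    using sum_toward_eq_edge_sum[OF assms, of "\<lambda>a b. c"] unfolding sum_pairs_const by (auto simp: symmetric_def mult_ac)
  then have "edge_sum T (\<lambda>a b. c) / 2 = (real n - 1) * c"
    using n by (simp only: mult_cancel_left) simp
  then show ?thesis by simp
qed

lemma sum_pair_indicator:
  assumes "(p, q) \<in> pairs" "symmetric w"
  shows "(\<Sum>(a, b)\<in>pairs. w a b * of_bool ({a, b} = {p, q})) = 2 * w p q"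
proof -
  have "(\<Sum>(a, b)\<in>pairs. w a b * of_bool ({a, b} = {p, q})) = (\<Sum>(a, b)\<in>{(p, q), (q, p)}. w a b)"
    using assms(1)
    by (intro sum.mono_neutral_cong_right finite_pairs) (auto simp: mem_pairs doubleton_eq_iff)
  also have "\<dots> = 2 * w p q"
    using assms by (auto simp: mem_pairs symmetricD[of w q p])
  finally show ?thesis .
qed

text \<open>If \<open>x\<close> is already adjacent to \<open>v\<close>, the swap is trivial and the
  two corrections cancel; otherwise \<open>{v, x}\<close> is absent from \<open>T\<close>.\<close>

lemma edge_ind_swap:
  assumes T: "T \<in> trees" and vx: "(v, x) \<in> pairs"
  shows "edge_ind (swap T v x) a b
      = edge_ind T a b - of_bool ({a, b} = {v, toward T v x}) + of_bool ({a, b} = {v, x})"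
proof (cases "toward T v x = x")
  case True
  then have "swap T v x = T" using toward_pairs(2)[OF T vx] by (auto simp: swap_def)
  then show ?thesis using True by simp
next
  case False
  have "{v, x} \<notin> T" using not_adjacent_if_toward_neq[of V T v x] T False by (simp add: mem_trees_iff)
  moreover have "{v, toward T v x} \<in> T" by (rule toward_pairs(2)[OF T vx])
  moreover have "{v, x} \<noteq> {v, toward T v x}" using False by (auto simp: doubleton_eq_iff)
  ultimately show ?thesis
    unfolding edge_ind_def swap_def by (cases "{a, b} = {v, x}"; cases "{a, b} = {v, toward T v x}") auto
qed

lemma edge_sum_swap:
  assumes T: "T \<in> trees" and vx: "(v, x) \<in> pairs" and w: "symmetric w"
  shows "edge_sum (swap T v x) w = edge_sum T w + 2 * w v x - 2 * w v (toward T v x)"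
  using sum_pair_indicator[OF vx w] sum_pair_indicator[OF toward_pairs(1)[OF T vx] w]
  by (simp add: edge_sum_def edge_ind_swap[OF T vx] distrib_left right_diff_distrib sum_pairs_add sum_pairs_diff)

text \<open>The swap identity replaces the square by differences over a single swap, as in an
  Efron--Stein bound.\<close>

lemma E_edge_sum_square:
  assumes w: "symmetric w" and z: "(\<Sum>(v, x)\<in>pairs. w v x) = 0"
  shows "E (\<lambda>T. (edge_sum T w)\<^sup>2) \<le> 8 / real n * (\<Sum>(v, x)\<in>pairs. (w v x)\<^sup>2)"
proof -
  let ?S = "\<Sum>(v, x)\<in>pairs. (w v x)\<^sup>2"
  have "real n / 2 * E (\<lambda>T. (edge_sum T w)\<^sup>2) = E (\<lambda>T. \<Sum>(v, x)\<in>pairs. w v x * edge_sum (swap T v x) w)"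
    using E_edge_sum_times[OF w, of "\<lambda>T. edge_sum T w"] by (simp add: power2_eq_square)
  also have "\<dots> \<le> E (\<lambda>T. \<Sum>(v, x)\<in>pairs. edge_sum T w * w v x + (3 * (w v x)\<^sup>2 + (w v (toward T v x))\<^sup>2 * 1))"
  proof (intro avg_mono sum_pairs_mono)
    fix T v x assume "T \<in> trees" "(v, x) \<in> pairs"
    note l = edge_sum_swap[OF this w]
    have "0 \<le> (w v x + w v (toward T v x))\<^sup>2" by simp
    then show "w v x * edge_sum (swap T v x) w
        \<le> edge_sum T w * w v x + (3 * (w v x)\<^sup>2 + (w v (toward T v x))\<^sup>2 * 1)"
      unfolding l power2_eq_square by (simp add: algebra_simps)
  qed
  also have "\<dots> = 4 * ?S"
    unfolding sum_pairs_add sum_pairs_cmult z avg_add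
      E_swap_toward[of "\<lambda>a b. (w a b)\<^sup>2" "\<lambda>T. 1"] by (simp add: E_const)
  finally show ?thesis using n by (simp add: field_simps)
qed

text \<open>Subtracting the mean weight shifts the edge sum by a deterministic amount, as the number
  of edges is fixed, and does not increase the sum of squares.\<close>

lemma E_edge_sum_centred_square:
  assumes w: "symmetric w"
  shows "E (\<lambda>T. (edge_sum T w - 2 / real n * (\<Sum>(v, x)\<in>pairs. w v x))\<^sup>2)
    \<le> 8 / real n * (\<Sum>(v, x)\<in>pairs. (w v x)\<^sup>2)"
proof -
  define s where "s = (\<Sum>(v, x)\<in>pairs. w v x)"
  define N where "N = real n * (real n - 1)"
  have N: "N > 0" using n by (simp add: N_def)
  define w' where "w' = (\<lambda>a b. w a b - s / N)"
  have w': "symmetric w'" using w by (auto simp: w'_def symmetric_def)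
  have z: "(\<Sum>(v, x)\<in>pairs. w' v x) = 0"
    unfolding w'_def sum_pairs_diff sum_pairs_const s_def[symmetric] N_def[symmetric] using N by simp
  have "E (\<lambda>T. (edge_sum T w - 2 / real n * s)\<^sup>2) = E (\<lambda>T. (edge_sum T w')\<^sup>2)"
  proof (rule avg_cong)
    fix T assume T: "T \<in> trees"
    have "edge_sum T w' = edge_sum T w - 2 / real n * s"
    proof -
      define r where "r = real n - 1"
      have "r \<noteq> 0" "real n \<noteq> 0" using n by (auto simp: r_def)
      then have "2 * r * (s / (real n * r)) = 2 / real n * s" by simp
      then show ?thesis unfolding w'_def edge_sum_diff edge_sum_const[OF T] N_def r_def by simp
    qed
    then show "(edge_sum T w - 2 / real n * s)\<^sup>2 = (edge_sum T w')\<^sup>2" by simp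
  qed
  also have "\<dots> \<le> 8 / real n * (\<Sum>(v, x)\<in>pairs. (w' v x)\<^sup>2)"
    by (rule E_edge_sum_square[OF w' z])
  finally have 1: "E (\<lambda>T. (edge_sum T w - 2 / real n * s)\<^sup>2) \<le> 8 / real n * (\<Sum>(v, x)\<in>pairs. (w' v x)\<^sup>2)" .
  have "(\<Sum>(v, x)\<in>pairs. (w' v x)\<^sup>2)
      = (\<Sum>(v, x)\<in>pairs. (w v x)\<^sup>2 - (2 * (s / N)) * w v x + (s / N)\<^sup>2)"
    by (rule sum_pairs_cong) (simp add: w'_def power2_eq_square algebra_simps)
  also have "\<dots> = (\<Sum>(v, x)\<in>pairs. (w v x)\<^sup>2) - 2 * (s / N) * s + N * (s / N)\<^sup>2"
    unfolding sum_pairs_add sum_pairs_diff sum_pairs_cmult sum_pairs_const s_def N_def by simp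
  also have "\<dots> = (\<Sum>(v, x)\<in>pairs. (w v x)\<^sup>2) - s\<^sup>2 / N"
    using N by (simp add: power2_eq_square field_simps)
  also have "\<dots> \<le> (\<Sum>(v, x)\<in>pairs. (w v x)\<^sup>2)" using N by simp
  finally have "8 / real n * (\<Sum>(v, x)\<in>pairs. (w' v x)\<^sup>2) \<le> 8 / real n * (\<Sum>(v, x)\<in>pairs. (w v x)\<^sup>2)"
    by (rule mult_left_mono) simp
  with 1 show ?thesis unfolding s_def by (rule order.trans)
qed


section \<open>Crossing counts of chords and of the tree\<close>

definition chord_cr :: "nat set set \<Rightarrow> nat \<Rightarrow> nat \<Rightarrow> real" where
  "chord_cr T v x = edge_sum T (cross_ind v x) / 2"

definition crossing_chords :: "nat \<Rightarrow> nat \<Rightarrow> real" where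
  "crossing_chords v x = (\<Sum>(y, z)\<in>pairs. cross_ind v x y z) / 2"

text \<open>Each crossing is seen from both of its edges, and the outer sum takes an edge in both
  orientations: hence the 4. The orientation of the other edge is already accounted for in
  \<open>chord_cr\<close>.\<close>

definition crossing_number :: "nat set set \<Rightarrow> real" where
  "crossing_number T = (\<Sum>(v, x)\<in>pairs. edge_ind T v x * chord_cr T v x) / 4"

text \<open>The subtracted term is the expectation of \<open>chord_cr\<close>, since every pair is
  an edge with probability 2/n.\<close>

definition deviation :: "nat set set \<Rightarrow> nat \<Rightarrow> nat \<Rightarrow> real" where
  "deviation T v x = chord_cr T v x - 2 / real n * crossing_chords v x"

lemma symmetric_cross_ind: "symmetric (cross_ind v x)"
  unfolding symmetric_def using cross_ind_commute(2) by blast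

lemma symmetric_chord_cr: "symmetric (chord_cr T)"
  unfolding symmetric_def chord_cr_def by (metis cross_ind_commute(1) edge_sum_cong)

lemma symmetric_crossing_chords: "symmetric crossing_chords"
  unfolding symmetric_def crossing_chords_def by (metis (no_types, lifting) cross_ind_commute(1) sum_pairs_cong)

lemma cross_ind_bounds: "0 \<le> cross_ind v x y z" "cross_ind v x y z \<le> 1" "(cross_ind v x y z)\<^sup>2 \<le> 1"
  by (auto simp: cross_ind_def)

lemma chord_cr_bounds:
  assumes "T \<in> trees"
  shows "0 \<le> chord_cr T v x" "chord_cr T v x \<le> real n"
proof -
  show "0 \<le> chord_cr T v x"
    unfolding chord_cr_def edge_sum_def using cross_ind_bounds by (auto intro!: sum_nonneg simp: edge_ind_def)
  have "edge_sum T (cross_ind v x) \<le> edge_sum T (\<lambda>a b. 1)" using cross_ind_bounds by (intro edge_sum_mono) auto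
  then show "chord_cr T v x \<le> real n" unfolding chord_cr_def edge_sum_const[OF assms] by simp
qed

lemma chord_cr_swap:
  assumes "T \<in> trees" "(v, x) \<in> pairs"
  shows "chord_cr (swap T v x) p q = chord_cr T p q + cross_ind p q v x - cross_ind p q v (toward T v x)"
  unfolding chord_cr_def edge_sum_swap[OF assms symmetric_cross_ind] by (simp add: field_simps)

lemma cross_ind_shared: "cross_ind v y v x = 0"
  using not_crosses_shared by (simp add: cross_ind_def)

lemma chord_cr_swap_same:
  assumes "T \<in> trees" "(v, x) \<in> pairs"
  shows "chord_cr (swap T v x) v y = chord_cr T v y"
  unfolding chord_cr_swap[OF assms] by (simp add: cross_ind_shared)

lemma deviation_swap_same:
  assumes "T \<in> trees" "(v, x) \<in> pairs"
  shows "deviation (swap T v x) v y = deviation T v y"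
  unfolding deviation_def chord_cr_swap_same[OF assms] ..

lemma crossing_number_eq_edge_sum: "crossing_number T = edge_sum T (chord_cr T) / 4"
  by (simp add: crossing_number_def edge_sum_def mult.commute)

lemma edge_sum_cross_ind_fst: "edge_sum T (\<lambda>a b. cross_ind a b v x) = 2 * chord_cr T v x"
  unfolding chord_cr_def using cross_ind_commute(3) by (simp add: edge_sum_def)

text \<open>There are two equal contributions: the exchanged edge brings in its own count, and the
  counts along the edges of \<open>T\<close> change by the same total, because crossing is
  symmetric.\<close>

lemma crossing_number_swap:
  assumes T: "T \<in> trees" and vx: "(v, x) \<in> pairs"
  shows "crossing_number (swap T v x) = crossing_number T + (chord_cr T v x - chord_cr T v (toward T v x))"
proof -
  have "crossing_number (swap T v x)
      = (edge_sum T (chord_cr (swap T v x)) + 2 * chord_cr T v x - 2 * chord_cr T v (toward T v x)) / 4"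
    unfolding crossing_number_eq_edge_sum edge_sum_swap[OF T vx symmetric_chord_cr] chord_cr_swap_same[OF T vx] ..
  also have "edge_sum T (chord_cr (swap T v x))
      = edge_sum T (\<lambda>p q. chord_cr T p q + cross_ind p q v x - cross_ind p q v (toward T v x))"
    by (intro edge_sum_cong chord_cr_swap[OF T vx])
  also have "\<dots> = edge_sum T (chord_cr T) + 2 * chord_cr T v x - 2 * chord_cr T v (toward T v x)"
    unfolding edge_sum_diff edge_sum_add edge_sum_cross_ind_fst ..
  finally show ?thesis by (simp add: crossing_number_eq_edge_sum field_simps)
qed

text \<open>Double counting of the crossings between arbitrary chords and edges of
  \<open>T\<close>.\<close>

lemma sum_chord_cr: "(\<Sum>(v, x)\<in>pairs. chord_cr T v x) = edge_sum T crossing_chords"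
proof -
  have "2 * (\<Sum>(v, x)\<in>pairs. chord_cr T v x) = (\<Sum>(v, x)\<in>pairs. \<Sum>(y, z)\<in>pairs. cross_ind v x y z * edge_ind T y z)"
    unfolding sum_pairs_cmult[symmetric] by (rule sum_pairs_cong) (simp add: chord_cr_def edge_sum_def)
  also have "\<dots> = (\<Sum>(y, z)\<in>pairs. (\<Sum>(v, x)\<in>pairs. cross_ind y z v x) * edge_ind T y z)"
    by (subst sum_pairs_swap, subst cross_ind_commute(3)) (simp add: sum_distrib_right case_prod_unfold)
  also have "\<dots> = 2 * edge_sum T crossing_chords"
    by (simp add: edge_sum_def crossing_chords_def flip: sum_pairs_cmult)
  finally show ?thesis by simp
qed

text \<open>Here the weight depends on the tree, so \<open>E_edge_sum_times\<close> does not apply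
  directly. The argument still works because the counts at \<open>v\<close> survive a swap at
  \<open>v\<close>.\<close>

lemma E_crossing_number_times:
  "2 * real n * E (\<lambda>T. crossing_number T * F T) = E (\<lambda>T. \<Sum>(v, x)\<in>pairs. chord_cr T v x * F (swap T v x))"
proof -
  have "2 * real n * E (\<lambda>T. crossing_number T * F T) = E (\<lambda>T. (real n / 2 * edge_sum T (chord_cr T)) * F T)"
    unfolding avg_cmult[symmetric] by (intro avg_cong) (simp add: crossing_number_eq_edge_sum)
  also have "\<dots> = E (\<lambda>T. \<Sum>(v, x)\<in>pairs. chord_cr T v (toward T v x) * F T)"
  proof (rule avg_cong)
    fix T assume "T \<in> trees"
    from sum_toward_eq_edge_sum[OF this symmetric_chord_cr]
    have "real n / 2 * edge_sum T (chord_cr T) = (\<Sum>(v, x)\<in>pairs. chord_cr T v (toward T v x))" by simp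
    then show "(real n / 2 * edge_sum T (chord_cr T)) * F T = (\<Sum>(v, x)\<in>pairs. chord_cr T v (toward T v x) * F T)"
      by (simp only: sum_distrib_right case_prod_unfold)
  qed
  also have "\<dots> = E (\<lambda>T. \<Sum>(v, x)\<in>pairs. chord_cr (swap T v x) v x * F (swap T v x))"
    by (subst E_swap) (auto intro!: avg_cong sum_pairs_cong simp: toward_swap_trees)
  also have "\<dots> = E (\<lambda>T. \<Sum>(v, x)\<in>pairs. chord_cr T v x * F (swap T v x))"
    by (auto intro!: avg_cong sum_pairs_cong simp: chord_cr_swap_same)
  finally show ?thesis .
qed

section \<open>Stein identity for the crossing number\<close>

definition total_chords :: real where "total_chords = (\<Sum>(v, x)\<in>pairs. crossing_chords v x)"

text \<open>The exact expectation of \<open>crossing_number\<close>, as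
  \<open>E_crossing_number_stein_weight\<close> shows for constant \<open>F\<close>.\<close>

definition mean_crossings :: real where "mean_crossings = total_chords / (real n)\<^sup>2"

text \<open>This equals \<open>2 * chord_cr T v x - deviation T v x\<close>, which is how the
  deviations enter the identity.\<close>

definition stein_weight :: "nat set set \<Rightarrow> nat \<Rightarrow> nat \<Rightarrow> real" where
  "stein_weight T v x = chord_cr T v x + 2 / real n * crossing_chords v x"

lemma stein_weight_swap_same:
  assumes "T \<in> trees" "(v, x) \<in> pairs"
  shows "stein_weight (swap T v x) v y = stein_weight T v y"
  unfolding stein_weight_def chord_cr_swap_same[OF assms] ..

text \<open>The counts \<open>chord_cr\<close> sum to an edge sum with weight
  \<open>crossing_chords\<close>, so the swap identity matches the unwanted \<open>F T\<close> part
  against the second summand of \<open>stein_weight\<close> at the swapped tree. Only the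
  deterministic total is left, and it gives the mean.\<close>

lemma E_crossing_number_stein_weight:
  "2 * real n * E (\<lambda>T. (crossing_number T - mean_crossings) * F T)
    = E (\<lambda>T. \<Sum>(v, x)\<in>pairs. stein_weight T v x * (F (swap T v x) - F T))"
proof -
  have n0: "real n \<noteq> 0" using n by simp
  have "E (\<lambda>T. \<Sum>(v, x)\<in>pairs. stein_weight T v x * (F (swap T v x) - F T))
      = E (\<lambda>T. (\<Sum>(v, x)\<in>pairs. chord_cr T v x * F (swap T v x))
         + 2 / real n * (\<Sum>(v, x)\<in>pairs. crossing_chords v x * F (swap T v x))
         - (edge_sum T crossing_chords * F T + 2 / real n * (total_chords * F T)))"
    unfolding sum_chord_cr[symmetric] total_chords_def sum_distrib_left sum_distrib_right case_prod_unfold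
      sum.distrib[symmetric] sum_subtractf[symmetric]
    by (intro avg_cong sum.cong refl)
      (simp add: stein_weight_def distrib_right right_diff_distrib mult.assoc)
  also have "\<dots> = 2 * real n * E (\<lambda>T. crossing_number T * F T)
      + 2 / real n * (real n / 2 * E (\<lambda>T. edge_sum T crossing_chords * F T))
      - (E (\<lambda>T. edge_sum T crossing_chords * F T) + 2 / real n * (total_chords * E F))"
    unfolding avg_diff avg_add avg_cmult E_crossing_number_times E_edge_sum_times[OF symmetric_crossing_chords] ..
  also have "\<dots> = 2 * real n * (E (\<lambda>T. crossing_number T * F T) - mean_crossings * E F)"
    using n0 by (simp add: mean_crossings_def power2_eq_square field_simps)
  also have "\<dots> = 2 * real n * E (\<lambda>T. (crossing_number T - mean_crossings) * F T)"
    unfolding left_diff_distrib avg_diff avg_cmult ..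
  finally show ?thesis ..
qed

text \<open>Antisymmetrisation: the swap exchanges \<open>x\<close> with the first step and reverses
  the sign of the increment of \<open>F\<close>, so the weight may be replaced by half its
  difference. This is the jump itself minus half the difference of the deviations.\<close>

lemma E_crossing_number_stein:
  "2 * real n * E (\<lambda>T. (crossing_number T - mean_crossings) * F T)
    = E (\<lambda>T. \<Sum>(v, x)\<in>pairs. ((chord_cr T v x - chord_cr T v (toward T v x))
            - (deviation T v x - deviation T v (toward T v x)) / 2)
        * (F (swap T v x) - F T))"
proof -
  let ?A = "E (\<lambda>T. \<Sum>(v, x)\<in>pairs. stein_weight T v x * (F (swap T v x) - F T))"
  let ?B = "E (\<lambda>T. \<Sum>(v, x)\<in>pairs. stein_weight T v (toward T v x) * (F (swap T v x) - F T))"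
  have "?A = E (\<lambda>T. \<Sum>(v, x)\<in>pairs. (- 1) * (stein_weight T v (toward T v x) * (F (swap T v x) - F T)))"
    by (subst E_swap) (auto intro!: avg_cong sum_pairs_cong simp: stein_weight_swap_same swap_swap_trees algebra_simps)
  also have "\<dots> = - ?B" unfolding sum_pairs_cmult avg_cmult by simp
  finally have AB: "?A = - ?B" .
  have "E (\<lambda>T. \<Sum>(v, x)\<in>pairs. ((chord_cr T v x - chord_cr T v (toward T v x))
            - (deviation T v x - deviation T v (toward T v x)) / 2)
        * (F (swap T v x) - F T))
      = E (\<lambda>T. \<Sum>(v, x)\<in>pairs. 1 / 2 * (stein_weight T v x * (F (swap T v x) - F T)
        - stein_weight T v (toward T v x) * (F (swap T v x) - F T)))"
    by (intro avg_cong sum_pairs_cong) (simp add: stein_weight_def deviation_def field_simps)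
  also have "\<dots> = 1 / 2 * (?A - ?B)"
    unfolding sum_pairs_cmult avg_cmult sum_pairs_diff avg_diff ..
  also have "\<dots> = ?A" using AB by simp
  finally show ?thesis unfolding E_crossing_number_stein_weight by simp
qed

text \<open>The 2 is 8/4: the factor 8/n of the variance bound, at most n^2 for the squared weights,
  and 1/4 from the halving in \<open>chord_cr\<close>.\<close>

lemma E_deviation_square: "E (\<lambda>T. (deviation T v x)\<^sup>2) \<le> 2 * real n"
proof -
  have "E (\<lambda>T. (deviation T v x)\<^sup>2)
      = E (\<lambda>T. 1 / 4 * (edge_sum T (cross_ind v x) - 2 / real n * (\<Sum>(y, z)\<in>pairs. cross_ind v x y z))\<^sup>2)"
    by (intro avg_cong) (simp add: deviation_def chord_cr_def crossing_chords_def power2_eq_square field_simps)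
  also have "\<dots> \<le> 1 / 4 * (8 / real n * (\<Sum>(y, z)\<in>pairs. (cross_ind v x y z)\<^sup>2))"
    unfolding avg_cmult by (intro mult_left_mono E_edge_sum_centred_square symmetric_cross_ind) simp
  also have "\<dots> \<le> 1 / 4 * (8 / real n * (real n)\<^sup>2)"
  proof (intro mult_left_mono)
    have "(\<Sum>(y, z)\<in>pairs. (cross_ind v x y z)\<^sup>2) \<le> (\<Sum>(y, z)\<in>pairs. 1)"
      using cross_ind_bounds by (intro sum_pairs_mono) auto
    also have "\<dots> \<le> (real n)\<^sup>2" using card_pairs_le by (simp add: case_prod_unfold)
    finally show "(\<Sum>(y, z)\<in>pairs. (cross_ind v x y z)\<^sup>2) \<le> (real n)\<^sup>2" .
  qed auto
  finally show ?thesis using n by (simp add: power2_eq_square)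
qed

lemma E_abs_deviation: "E (\<lambda>T. \<bar>deviation T v x\<bar>) \<le> sqrt (2 * real n)"
  using avg_abs_le_sqrt[of trees "\<lambda>T. deviation T v x"] E_deviation_square[of v x]
  by (meson order.trans real_sqrt_le_mono)

lemma E_sum_deviation_next:
  "E (\<lambda>T. \<Sum>(v, x)\<in>pairs. \<bar>deviation T v (toward T v x)\<bar>) = E (\<lambda>T. \<Sum>(v, x)\<in>pairs. \<bar>deviation T v x\<bar>)"
  by (subst E_swap) (auto intro!: avg_cong sum_pairs_cong simp: toward_swap_trees deviation_swap_same)

lemma E_sum_deviation:
  "E (\<lambda>T. \<Sum>(v, x)\<in>pairs. \<bar>deviation T v x - deviation T v (toward T v x)\<bar>) \<le> 2 * (real n)\<^sup>2 * sqrt (2 * real n)"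
proof -
  have "E (\<lambda>T. \<Sum>(v, x)\<in>pairs. \<bar>deviation T v x - deviation T v (toward T v x)\<bar>)
      \<le> E (\<lambda>T. \<Sum>(v, x)\<in>pairs. \<bar>deviation T v x\<bar> + \<bar>deviation T v (toward T v x)\<bar>)"
    by (intro avg_mono sum_pairs_mono) simp
  also have "\<dots> = 2 * E (\<lambda>T. \<Sum>(v, x)\<in>pairs. \<bar>deviation T v x\<bar>)"
    unfolding sum_pairs_add avg_add E_sum_deviation_next by simp
  also have "\<dots> = 2 * (\<Sum>(v, x)\<in>pairs. E (\<lambda>T. \<bar>deviation T v x\<bar>))"
    by (simp add: E_sum_pairs)
  also have "\<dots> \<le> 2 * (\<Sum>(v, x)\<in>pairs. sqrt (2 * real n))"
    by (intro mult_left_mono sum_pairs_mono E_abs_deviation) simp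
  also have "\<dots> = 2 * real (card pairs) * sqrt (2 * real n)"
    by (simp add: case_prod_unfold)
  also have "\<dots> \<le> 2 * (real n)\<^sup>2 * sqrt (2 * real n)"
    by (intro mult_right_mono mult_left_mono card_pairs_le) auto
  finally show ?thesis .
qed

section \<open>Counting the chords that cross a given chord\<close>

text \<open>A crossing chord joins one of the vertices strictly between \<open>v\<close> and
  \<open>x\<close> to one of the vertices outside.\<close>

lemma crossing_chords_formula:
  assumes "v \<in> V" "x \<in> V" "v < x"
  shows "crossing_chords v x = (real (x - v) - 1) * (real n - 1 - real (x - v))"
proof -
  let ?in = "\<lambda>y. of_bool (v < y \<and> y < x) :: real" and ?out = "\<lambda>y. of_bool (y < v \<or> x < y) :: real"
  have "(\<Sum>(y, z)\<in>pairs. cross_ind v x y z) = (\<Sum>y\<in>V. \<Sum>z\<in>V - {y}. cross_ind v x y z)"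
    by (rule sum_pairs_nested)
  also have "\<dots> = (\<Sum>y\<in>V. \<Sum>z\<in>V. ?in y * ?out z + ?out y * ?in z)"
  proof (rule sum.cong[OF refl])
    fix y assume "y \<in> V"
    have "(\<Sum>z\<in>V - {y}. cross_ind v x y z) = (\<Sum>z\<in>V - {y}. ?in y * ?out z + ?out y * ?in z)"
      using assms by (intro sum.cong refl) (auto simp: cross_ind_def crosses_def min_def max_def)
    also have "\<dots> = (\<Sum>z\<in>V. ?in y * ?out z + ?out y * ?in z)"
      by (intro sum.mono_neutral_left) auto
    finally show "(\<Sum>z\<in>V - {y}. cross_ind v x y z) = (\<Sum>z\<in>V. ?in y * ?out z + ?out y * ?in z)" .
  qed
  also have "\<dots> = 2 * ((\<Sum>y\<in>V. ?in y) * (\<Sum>y\<in>V. ?out y))"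
    unfolding sum.distrib sum_distrib_left[symmetric] sum_distrib_right[symmetric] by simp
  also have "(\<Sum>y\<in>V. ?in y) = real (card {v<..<x})"
  proof -
    have "V \<inter> {y. v < y \<and> y < x} = {v<..<x}" using assms by auto
    then show ?thesis by (subst sum_of_bool_eq) (simp, simp only:)
  qed
  also have "(\<Sum>y\<in>V. ?out y) = real (card (V - {v..x}))"
  proof -
    have "V \<inter> {y. y < v \<or> x < y} = V - {v..x}" using assms by auto
    then show ?thesis by (subst sum_of_bool_eq) (simp, simp only:)
  qed
  also have "real (card {v<..<x}) = real (x - v) - 1"
    using assms by (simp add: of_nat_diff)
  also have "real (card (V - {v..x})) = real n - 1 - real (x - v)"
    using assms by (subst card_Diff_subset) (auto simp: of_nat_diff)
  finally show ?thesis by (simp add: crossing_chords_def)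
qed

definition chords_at :: "nat \<Rightarrow> real" where
  "chords_at d = (real d - 1) * (real n - 1 - real d)"

text \<open>Rotational symmetry of the polygon: lengths d and n - d give equal counts, so the
  lengths to vertices above \<open>v\<close>, reflected, complete those to vertices below
  \<open>v\<close> to 1, ..., n - 1.\<close>

lemma sum_crossing_chords_row:
  fixes f :: "real \<Rightarrow> real"
  assumes v: "v \<in> V"
  shows "(\<Sum>x\<in>V - {v}. f (crossing_chords v x)) = (\<Sum>d\<in>{1..<n}. f (chords_at d))"
proof -
  have chords_at_refl: "chords_at (n - d) = chords_at d" if "d \<le> n" for d
    using that by (simp add: chords_at_def of_nat_diff)
  have "V - {v} = {1..<v} \<union> {v<..n}" using v by auto
  moreover have "(\<Sum>x\<in>{1..<v} \<union> {v<..n}. f (crossing_chords v x))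
      = (\<Sum>x\<in>{1..<v}. f (crossing_chords v x)) + (\<Sum>x\<in>{v<..n}. f (crossing_chords v x))"
    by (rule sum.union_disjoint) auto
  ultimately have "(\<Sum>x\<in>V - {v}. f (crossing_chords v x))
      = (\<Sum>x\<in>{1..<v}. f (crossing_chords v x)) + (\<Sum>x\<in>{v<..n}. f (crossing_chords v x))" by (simp only:)
  also have "(\<Sum>x\<in>{1..<v}. f (crossing_chords v x)) = (\<Sum>d\<in>{1..<v}. f (chords_at d))"
  proof (rule sum.reindex_bij_witness[where i = "\<lambda>d. v - d" and j = "\<lambda>x. v - x"])
    fix x assume x: "x \<in> {1..<v}"
    have "crossing_chords v x = crossing_chords x v" using symmetricD[OF symmetric_crossing_chords] .
    also have "\<dots> = chords_at (v - x)" using x v by (subst crossing_chords_formula) (auto simp: chords_at_def)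
    finally show "f (chords_at (v - x)) = f (crossing_chords v x)" by simp
  qed auto
  also have "(\<Sum>x\<in>{v<..n}. f (crossing_chords v x)) = (\<Sum>d\<in>{v..<n}. f (chords_at d))"
  proof (rule sum.reindex_bij_witness[where i = "\<lambda>d. n + v - d" and j = "\<lambda>x. n + v - x"])
    fix x assume x: "x \<in> {v<..n}"
    have "crossing_chords v x = chords_at (x - v)" using x v by (subst crossing_chords_formula) (auto simp: chords_at_def)
    also have "\<dots> = chords_at (n - (x - v))" using x v by (subst chords_at_refl) auto
    also have "n - (x - v) = n + v - x" using x v by simp
    finally show "f (chords_at (n + v - x)) = f (crossing_chords v x)" by simp
  qed auto
  also have "(\<Sum>d\<in>{1..<v}. f (chords_at d)) + (\<Sum>d\<in>{v..<n}. f (chords_at d)) = (\<Sum>d\<in>{1..<n}. f (chords_at d))"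
    using v by (intro sum.atLeastLessThan_concat) auto
  finally show ?thesis .
qed

lemma sum_crossing_chords:
  fixes f :: "real \<Rightarrow> real"
  shows "(\<Sum>(v, x)\<in>pairs. f (crossing_chords v x)) = real n * (\<Sum>d\<in>{1..<n}. f (chords_at d))"
proof -
  have "(\<Sum>(v, x)\<in>pairs. f (crossing_chords v x)) = (\<Sum>v\<in>V. \<Sum>d\<in>{1..<n}. f (chords_at d))"
    unfolding sum_pairs_nested by (rule sum.cong[OF refl sum_crossing_chords_row])
  then show ?thesis by simp
qed

lemma chords_at_bounds:
  assumes "d \<in> {1..<n}"
  shows "0 \<le> chords_at d" "chords_at d \<le> (real n)\<^sup>2"
proof -
  have d: "1 \<le> real d" "real d \<le> real n - 1" using assms n by (auto simp flip: of_nat_diff)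
  then show "0 \<le> chords_at d" unfolding chords_at_def by (intro mult_nonneg_nonneg) auto
  show "chords_at d \<le> (real n)\<^sup>2"
    unfolding chords_at_def power2_eq_square using d by (intro mult_mono) auto
qed

text \<open>The average of \<open>chords_at\<close> over all lengths. With this centring every
  single row sums to 0, not merely the total; the covariance estimate relies on it.\<close>

definition mean_chords :: real where "mean_chords = (real n - 2) * (real n - 3) / 6"

definition centred_chords :: "nat \<Rightarrow> nat \<Rightarrow> real" where "centred_chords v x = crossing_chords v x - mean_chords"

lemma sum_chords_at_shift: "(\<Sum>d\<in>{1..<n}. f (chords_at d)) = (\<Sum>j<n - 1. f (real j * (real n - 2 - real j)))"
  by (rule sum.reindex_bij_witness[where i = Suc and j = "\<lambda>d. d - 1"])
    (auto simp: chords_at_def of_nat_diff algebra_simps)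

lemma real_n_minus_1: "real (n - 1) = real n - 1"
  using n by (simp add: of_nat_diff)

lemma sum_chords_at: "(\<Sum>d\<in>{1..<n}. chords_at d) = (real n - 1) * mean_chords"
  unfolding sum_chords_at_shift[of "\<lambda>t. t"] sum_chord_lengths real_n_minus_1 mean_chords_def
  by (simp add: field_simps)

lemma sum_chords_at_square: "(\<Sum>d\<in>{1..<n}. (chords_at d)\<^sup>2) = ((real n - 2) ^ 5 - (real n - 2)) / 30"
  unfolding sum_chords_at_shift[of "\<lambda>t. t\<^sup>2"] sum_chord_lengths_square real_n_minus_1
  by (simp add: field_simps eval_nat_numeral)

lemma centred_chords_row: "v \<in> V \<Longrightarrow> (\<Sum>x\<in>V - {v}. centred_chords v x) = 0"
  using sum_crossing_chords_row[of v "\<lambda>t. t - mean_chords"] n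
  by (simp add: centred_chords_def sum_subtractf sum_chords_at real_n_minus_1 del: One_nat_def)

lemma total_chords_eq: "total_chords = real n * (real n - 1) * mean_chords"
  using sum_crossing_chords[of "\<lambda>t. t"] by (simp add: total_chords_def sum_chords_at del: One_nat_def)

text \<open>The exact mean is n^2/6 - n + 11/6 - 1/n. Measured against a standard deviation of order
  n^(3/2), the gap costs O(n^(-1/2)), within the claimed rate.\<close>

lemma mean_crossings_bound: "\<bar>mean_crossings - (real n)\<^sup>2 / 6\<bar> \<le> real n"
proof -
  have "mean_crossings - (real n)\<^sup>2 / 6 = - (real n - 11 / 6 + 1 / real n)"
    unfolding mean_crossings_def total_chords_eq mean_chords_def using n by (simp add: field_simps power2_eq_square)
  moreover have "0 \<le> 1 / real n" "1 / real n \<le> 1" "real n \<ge> 4" using n by auto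
  ultimately show ?thesis by linarith
qed

text \<open>The coefficient 1/180 is 1/30 - 1/36, second moment minus squared mean; 21 = 5 + 5 + 5 +
  6 collects the lower coefficients.\<close>

lemma sum_centred_chords_square: "\<bar>180 * (\<Sum>(v, x)\<in>pairs. (centred_chords v x)\<^sup>2) - real n ^ 6\<bar> \<le> 21 * real n ^ 5"
proof -
  define r where "r = real n"
  have r: "r \<ge> 1" using n by (simp add: r_def)
  have "(\<Sum>(v, x)\<in>pairs. (centred_chords v x)\<^sup>2) = real n * (\<Sum>d\<in>{1..<n}. (chords_at d - mean_chords)\<^sup>2)"
    using sum_crossing_chords[of "\<lambda>t. (t - mean_chords)\<^sup>2"] by (simp add: centred_chords_def)
  also have "(\<Sum>d\<in>{1..<n}. (chords_at d - mean_chords)\<^sup>2)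
      = (\<Sum>d\<in>{1..<n}. (chords_at d)\<^sup>2) - 2 * mean_chords * (\<Sum>d\<in>{1..<n}. chords_at d) + (real n - 1) * mean_chords\<^sup>2"
    by (simp add: power2_diff sum.distrib sum_subtractf sum_distrib_left real_n_minus_1 mult_ac
        del: One_nat_def)
  also have "\<dots> = (\<Sum>d\<in>{1..<n}. (chords_at d)\<^sup>2) - (real n - 1) * mean_chords\<^sup>2"
    unfolding sum_chords_at by (simp add: power2_eq_square algebra_simps)
  finally have "180 * (\<Sum>(v, x)\<in>pairs. (centred_chords v x)\<^sup>2)
      = r * (6 * ((r - 2) ^ 5 - (r - 2)) - 5 * (r - 1) * ((r - 2) * (r - 3))\<^sup>2)"
    unfolding sum_chords_at_square mean_chords_def r_def by (simp add: power2_eq_square field_simps)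
  also have "\<dots> = r ^ 6 + (- 5 * r ^ 5 + 5 * r ^ 4 + 5 * r ^ 3 - 6 * r\<^sup>2)"
    by (simp add: eval_nat_numeral algebra_simps)
  finally have "180 * (\<Sum>(v, x)\<in>pairs. (centred_chords v x)\<^sup>2) - r ^ 6
      = - 5 * r ^ 5 + 5 * r ^ 4 + 5 * r ^ 3 - 6 * r\<^sup>2" by simp
  moreover have "0 \<le> r ^ 4" "0 \<le> r ^ 3" "0 \<le> r\<^sup>2" using r by auto
  moreover have "r ^ 4 \<le> r ^ 5" "r ^ 3 \<le> r ^ 5" "r\<^sup>2 \<le> r ^ 5"
    using r by (auto intro!: power_increasing)
  ultimately show ?thesis unfolding r_def[symmetric] by linarith
qed

lemma crossing_chords_bounds:
  assumes "(v, x) \<in> pairs"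
  shows "0 \<le> crossing_chords v x" "crossing_chords v x \<le> (real n)\<^sup>2"
proof -
  have aux: "0 \<le> crossing_chords v x \<and> crossing_chords v x \<le> (real n)\<^sup>2" if "v < x" "v \<in> V" "x \<in> V" for v x
  proof -
    have "crossing_chords v x = chords_at (x - v)" using that by (simp add: crossing_chords_formula chords_at_def)
    moreover have "x - v \<in> {1..<n}" using that by auto
    ultimately show ?thesis using chords_at_bounds by auto
  qed
  have "0 \<le> crossing_chords v x \<and> crossing_chords v x \<le> (real n)\<^sup>2"
    using aux[of v x] aux[of x v] assms symmetricD[OF symmetric_crossing_chords, of v x]
    by (cases "v < x") (auto simp: mem_pairs)
  then show "0 \<le> crossing_chords v x" "crossing_chords v x \<le> (real n)\<^sup>2" by auto
qed

lemma centred_chords_bound: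
  assumes "(v, x) \<in> pairs"
  shows "\<bar>centred_chords v x\<bar> \<le> (real n)\<^sup>2"
proof -
  have "0 \<le> mean_chords" unfolding mean_chords_def using n by (auto intro!: divide_nonneg_nonneg mult_nonneg_nonneg)
  have "(real n - 2) * (real n - 3) \<le> real n * real n" using n by (intro mult_mono) auto
  moreover have "0 \<le> real n * real n" by simp
  ultimately have "mean_chords \<le> (real n)\<^sup>2" unfolding mean_chords_def power2_eq_square by linarith
  moreover have "0 \<le> mean_chords" by fact
  ultimately show ?thesis using crossing_chords_bounds[OF assms] unfolding centred_chords_def by (auto simp: abs_le_iff)
qed

lemma symmetric_centred_chords: "symmetric centred_chords"
  using symmetric_crossing_chords by (simp add: symmetric_def centred_chords_def)

section \<open>Exchanging two labels\<close>

lemma E_transpose: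
  assumes xy: "x \<in> V" "y \<in> V"
  shows "E F = E (\<lambda>T. F ((`) (Transposition.transpose x y) ` T))"
proof -
  let ?\<tau> = "Transposition.transpose x y"
  have inv: "(`) ?\<tau> ` (`) ?\<tau> ` T = T" for T
    by (simp add: image_image)
  have V: "?\<tau> ` V = V"
  proof -
    have "?\<tau> ` V \<subseteq> V" using xy by (auto simp: Transposition.transpose_def)
    then show ?thesis by (simp add: card_image endo_inj_surj)
  qed
  have mem: "(`) ?\<tau> ` T \<in> trees" if "T \<in> trees" for T
    using that tree_image[OF _ bij_transpose V] by (simp add: mem_trees_iff)
  have "(\<Sum>T\<in>trees. F T) = (\<Sum>T\<in>trees. F ((`) ?\<tau> ` T))"
    by (rule sum.reindex_bij_witness[where i = "\<lambda>T. (`) ?\<tau> ` T" and j = "\<lambda>T. (`) ?\<tau> ` T"])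
      (auto simp: inv mem)
  then show ?thesis by (simp add: avg_def)
qed

lemma toward_transpose:
  assumes T: "T \<in> trees" and xy: "x \<in> V" "y \<in> V" and v: "(v, a) \<in> pairs" "v \<noteq> x" "v \<noteq> y"
  shows "toward ((`) (Transposition.transpose x y) ` T) v (Transposition.transpose x y a)
    = Transposition.transpose x y (toward T v a)"
proof -
  let ?\<tau> = "Transposition.transpose x y"
  have V: "?\<tau> ` V = V"
  proof -
    have "?\<tau> ` V \<subseteq> V" using xy by (auto simp: Transposition.transpose_def)
    then show ?thesis by (simp add: card_image endo_inj_surj)
  qed
  have "?\<tau> v = v" using v by (simp add: Transposition.transpose_def)
  then show ?thesis
    using toward_image[OF _ bij_transpose V, of T v a] T v by (simp add: mem_trees_iff mem_pairs)
qed

lemma E_edge_ind: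
  assumes "(v, x) \<in> pairs"
  shows "E (\<lambda>T. edge_ind T v x) = 2 / real n"
proof -
  define w where "w = (\<lambda>a b. of_bool ({a, b} = {v, x}) :: real)"
  have w: "symmetric w" by (simp add: w_def symmetric_def insert_commute)
  have "edge_sum T w = 2 * edge_ind T v x" for T
    using sum_pair_indicator[OF assms, of "edge_ind T"]
    by (simp add: edge_sum_def w_def symmetric_def edge_ind_commute mult.commute)
  moreover have "(\<Sum>(a, b)\<in>pairs. w a b) = 2"
    using sum_pair_indicator[OF assms, of "\<lambda>a b. 1"] by (simp add: w_def symmetric_def)
  ultimately show ?thesis using E_edge_sum[OF w] by (simp add: avg_cmult)
qed

text \<open>A summand of the square of \<open>vertex_term\<close> without its factor
  \<open>centred_chords v x\<close>, so that \<open>x\<close> enters only through the first step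
  towards it.\<close>

definition exchange_term :: "nat set set \<Rightarrow> nat \<Rightarrow> nat \<Rightarrow> nat \<Rightarrow> real" where
  "exchange_term T v x x' = centred_chords v (toward T v x) * (centred_chords v x' * centred_chords v (toward T v x'))"

lemma exchange_term_bound:
  assumes "T \<in> trees" "(v, x) \<in> pairs" "(v, x') \<in> pairs"
  shows "\<bar>exchange_term T v x x'\<bar> \<le> (real n) ^ 6"
proof -
  have "\<bar>exchange_term T v x x'\<bar> \<le> (real n)\<^sup>2 * ((real n)\<^sup>2 * (real n)\<^sup>2)"
    unfolding exchange_term_def abs_mult using assms by (intro mult_mono centred_chords_bound toward_pairs) auto
  then show ?thesis by (simp flip: power_add)
qed

text \<open>
  Exchanging the labels \<open>x\<close> and \<open>y\<close> turns the first term into the second, unless one of the two paths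
  from \<open>v\<close> starts at \<open>x\<close> or \<open>y\<close>; then \<open>{v, x}\<close> or \<open>{v, y}\<close> is an edge, which has probability \<open>O(1/n)\<close>.
\<close>

lemma exchange_term_swap:
  assumes pairs: "(v, x) \<in> pairs" "(v, y) \<in> pairs" "(v, x') \<in> pairs" and ne: "x' \<noteq> x" "x' \<noteq> y"
  shows "\<bar>E (\<lambda>T. exchange_term T v x x') - E (\<lambda>T. exchange_term T v y x')\<bar> \<le> 8 * real n ^ 5"
proof -
  let ?\<tau> = "Transposition.transpose x y"
  have xy: "x \<in> V" "y \<in> V" "v \<noteq> x" "v \<noteq> y" using pairs by (auto simp: mem_pairs)
  let ?F = "\<lambda>T. exchange_term ((`) ?\<tau> ` T) v x x' - exchange_term T v y x'"
  have pw: "\<bar>?F T\<bar> \<le> 2 * real n ^ 6 * (edge_ind T v x + edge_ind T v y)" if T: "T \<in> trees" for T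
  proof -
    have tT: "(`) ?\<tau> ` T \<in> trees"
    proof -
      have "?\<tau> ` V \<subseteq> V" using xy by (auto simp: Transposition.transpose_def)
      then have "?\<tau> ` V = V" by (simp add: card_image endo_inj_surj)
      then show ?thesis using T tree_image[OF _ bij_transpose] by (simp add: mem_trees_iff)
    qed
    have 1: "toward ((`) ?\<tau> ` T) v x = ?\<tau> (toward T v y)"
      using toward_transpose[OF T xy(1,2) pairs(2) xy(3,4)] by simp
    have 2: "toward ((`) ?\<tau> ` T) v x' = ?\<tau> (toward T v x')"
      using toward_transpose[OF T xy(1,2) pairs(3) xy(3,4)] ne by simp
    show ?thesis
    proof (cases "toward T v y \<in> {x, y} \<or> toward T v x' \<in> {x, y}")
      case True
      then have "{v, x} \<in> T \<or> {v, y} \<in> T"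
        using toward_pairs(2)[OF T pairs(2)] toward_pairs(2)[OF T pairs(3)] by auto
      then have "1 \<le> edge_ind T v x + edge_ind T v y" by (auto simp: edge_ind_def)
      then have "2 * real n ^ 6 * 1 \<le> 2 * real n ^ 6 * (edge_ind T v x + edge_ind T v y)"
        by (intro mult_left_mono) auto
      moreover have "\<bar>?F T\<bar> \<le> 2 * real n ^ 6"
        using exchange_term_bound[OF tT pairs(1,3)] exchange_term_bound[OF T pairs(2,3)] by linarith
      ultimately show ?thesis by linarith
    next
      case False
      then have "?F T = 0" unfolding exchange_term_def 1 2 by simp
      then show ?thesis by (simp add: edge_ind_def)
    qed
  qed
  have eq: "E (\<lambda>T. exchange_term T v x x') - E (\<lambda>T. exchange_term T v y x') = E ?F"
    unfolding avg_diff by (subst E_transpose[OF xy(1,2)]) simp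
  have "\<bar>E (\<lambda>T. exchange_term T v x x') - E (\<lambda>T. exchange_term T v y x')\<bar> \<le> E (\<lambda>T. \<bar>?F T\<bar>)"
    unfolding eq by (rule abs_avg_le)
  also have "\<dots> \<le> E (\<lambda>T. 2 * real n ^ 6 * (edge_ind T v x + edge_ind T v y))"
    using pw by (rule avg_mono)
  also have "\<dots> = 8 * real n ^ 5"
    unfolding avg_cmult avg_add E_edge_ind[OF pairs(1)] E_edge_ind[OF pairs(2)]
    using n by (simp add: field_simps eval_nat_numeral)
  finally show ?thesis .
qed

definition vertex_term :: "nat set set \<Rightarrow> nat \<Rightarrow> real" where
  "vertex_term T v = (\<Sum>x\<in>V - {v}. centred_chords v x * centred_chords v (toward T v x))"

text \<open>Bounding every factor by n^2 would give n^10. One factor n is gained because the row of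
  \<open>centred_chords\<close> sums to 0: the value at a reference vertex \<open>y\<close> may be
  subtracted from \<open>A x x'\<close>, and the difference is small unless
  \<open>x = x'\<close>.\<close>

lemma E_vertex_term_square:
  assumes v: "v \<in> V"
  shows "E (\<lambda>T. (vertex_term T v)\<^sup>2) \<le> 10 * real n ^ 9"
proof -
  let ?U = "V - {v}"
  define A where "A = (\<lambda>x x'. E (\<lambda>T. exchange_term T v x x'))"
  have mem: "(v, x) \<in> pairs" if "x \<in> ?U" for x using that v by (auto simp: mem_pairs)
  have cardU: "real (card ?U) \<le> real n" using v by simp
  have A_le: "\<bar>A x x'\<bar> \<le> real n ^ 6" if "x \<in> ?U" "x' \<in> ?U" for x x'
  proof -
    have "\<bar>A x x'\<bar> \<le> E (\<lambda>T. \<bar>exchange_term T v x x'\<bar>)" unfolding A_def by (rule abs_avg_le)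
    also have "\<dots> \<le> E (\<lambda>T. real n ^ 6)" using that by (intro avg_mono exchange_term_bound mem)
    finally show ?thesis by (simp add: E_const)
  qed
  have row: "(\<Sum>x\<in>?U. centred_chords v x * A x x') \<le> 10 * real n ^ 8" if x': "x' \<in> ?U" for x'
  proof -
    \<comment> \<open>Three candidates suffice to avoid two vertices, and \<open>n\<close> being at
      least 4 puts them in \<open>V\<close>.\<close>
    have "\<exists>y\<in>{1,2,3::nat}. y \<noteq> v \<and> y \<noteq> x'" by auto
    then obtain y where "y \<in> {1,2,3}" "y \<noteq> v" "y \<noteq> x'" by blast
    then have y: "y \<in> ?U" "y \<noteq> x'" using n by auto
    have "(\<Sum>x\<in>?U. centred_chords v x * A x x') = (\<Sum>x\<in>?U. centred_chords v x * (A x x' - A y x'))"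
      using centred_chords_row[OF v] by (simp add: right_diff_distrib sum_subtractf flip: sum_distrib_right)
    also have "\<dots> \<le> (\<Sum>x\<in>?U. (real n)\<^sup>2 * (8 * real n ^ 5 + 2 * real n ^ 6 * of_bool (x = x')))"
    proof (rule sum_mono)
      fix x assume x: "x \<in> ?U"
      have "\<bar>A x x' - A y x'\<bar> \<le> 8 * real n ^ 5 + 2 * real n ^ 6 * of_bool (x = x')"
      proof (cases "x = x'")
        case True
        have nonneg: "0 \<le> real n ^ 5" by simp
        have one: "of_bool (x = x') = (1 :: real)" using True by simp
        show ?thesis unfolding one using nonneg A_le[OF x x'] A_le[OF y(1) x'] by linarith
      next
        case False
        then show ?thesis using exchange_term_swap[OF mem[OF x] mem[OF y(1)] mem[OF x']] y(2)
          by (simp add: A_def)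
      qed
      then have "\<bar>centred_chords v x\<bar> * \<bar>A x x' - A y x'\<bar>
          \<le> (real n)\<^sup>2 * (8 * real n ^ 5 + 2 * real n ^ 6 * of_bool (x = x'))"
        using centred_chords_bound[OF mem[OF x]] by (intro mult_mono) auto
      then show "centred_chords v x * (A x x' - A y x')
          \<le> (real n)\<^sup>2 * (8 * real n ^ 5 + 2 * real n ^ 6 * of_bool (x = x'))"
        using abs_ge_self[of "centred_chords v x * (A x x' - A y x')"] unfolding abs_mult by (rule order.trans[rotated])
    qed
    also have "\<dots> = (real n)\<^sup>2 * (real (card ?U) * (8 * real n ^ 5) + 2 * real n ^ 6)"
      using x' by (simp add: sum.distrib flip: sum_distrib_left)
    also have "\<dots> \<le> (real n)\<^sup>2 * (real n * (8 * real n ^ 5) + 2 * real n ^ 6)"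
      using cardU by (intro mult_left_mono add_right_mono mult_right_mono) auto
    also have "\<dots> = 10 * real n ^ 8" by (simp add: eval_nat_numeral algebra_simps)
    finally show ?thesis .
  qed
  have "E (\<lambda>T. (vertex_term T v)\<^sup>2) = E (\<lambda>T. \<Sum>x'\<in>?U. \<Sum>x\<in>?U. centred_chords v x * exchange_term T v x x')"
    unfolding vertex_term_def power2_eq_square sum_product exchange_term_def
    by (intro avg_cong, subst sum.swap) (simp add: mult_ac)
  also have "\<dots> = (\<Sum>x'\<in>?U. \<Sum>x\<in>?U. centred_chords v x * A x x')"
    unfolding A_def by (simp add: avg_sum avg_cmult)
  also have "\<dots> \<le> (\<Sum>x'\<in>?U. 10 * real n ^ 8)"
    using row by (rule sum_mono)
  also have "\<dots> \<le> real n * (10 * real n ^ 8)"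
    using cardU by (simp add: mult_right_mono)
  finally show ?thesis by (simp add: eval_nat_numeral algebra_simps)
qed

section \<open>Concentration of the squared jumps\<close>

abbreviation rn :: real where "rn \<equiv> sqrt (real n)"

lemma rn: "rn > 0" "rn * rn = real n" "1 \<le> rn"
  using n by auto

lemma sqrt_power_9: "sqrt (c * real n ^ 9) = sqrt c * (real n ^ 4 * rn)"
proof -
  have "real n ^ 9 = (real n ^ 4)\<^sup>2 * real n" by (simp add: eval_nat_numeral)
  then have "sqrt (c * real n ^ 9) = sqrt c * (sqrt ((real n ^ 4)\<^sup>2) * rn)"
    by (simp only: real_sqrt_mult)
  then show ?thesis by (simp only: real_sqrt_abs) simp
qed

lemma E_abs_covariance_le:
  "E (\<lambda>T. \<bar>\<Sum>(v, x)\<in>pairs. centred_chords v x * centred_chords v (toward T v x)\<bar>) \<le> 4 * real n ^ 5 * rn"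
proof -
  have Z: "E (\<lambda>T. \<bar>vertex_term T v\<bar>) \<le> 4 * (real n ^ 4 * rn)" if "v \<in> V" for v
  proof -
    have "E (\<lambda>T. \<bar>vertex_term T v\<bar>) \<le> sqrt (E (\<lambda>T. (vertex_term T v)\<^sup>2))" by (rule avg_abs_le_sqrt)
    also have "\<dots> \<le> sqrt (10 * real n ^ 9)"
      using E_vertex_term_square[OF that] by (rule real_sqrt_le_mono)
    also have "\<dots> = sqrt 10 * (real n ^ 4 * rn)" by (rule sqrt_power_9)
    also have "\<dots> \<le> 4 * (real n ^ 4 * rn)"
      by (intro mult_right_mono real_le_lsqrt) auto
    finally show ?thesis .
  qed
  have "E (\<lambda>T. \<bar>\<Sum>(v, x)\<in>pairs. centred_chords v x * centred_chords v (toward T v x)\<bar>) \<le> E (\<lambda>T. \<Sum>v\<in>V. \<bar>vertex_term T v\<bar>)"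
    unfolding sum_pairs_nested vertex_term_def by (intro avg_mono sum_abs)
  also have "\<dots> = (\<Sum>v\<in>V. E (\<lambda>T. \<bar>vertex_term T v\<bar>))" by (rule avg_sum)
  also have "\<dots> \<le> (\<Sum>v\<in>V. 4 * (real n ^ 4 * rn))" using Z by (rule sum_mono)
  also have "\<dots> = 4 * real n ^ 5 * rn" by (simp add: eval_nat_numeral)
  finally show ?thesis .
qed

text \<open>Replacing the counts by their means costs \<open>R\<close>. The remaining squares split
  into two diagonal parts, the constant \<open>S\<close> and an edge sum \<open>U\<close> that n/2
  brings to the same mean, and the cross term \<open>Y\<close>. The contributions 12, 38 and 4 add
  up to 54.\<close>

lemma E_variance:
  "E (\<lambda>T. \<bar>(\<Sum>(v, x)\<in>pairs. (chord_cr T v x - chord_cr T v (toward T v x))\<^sup>2) - 2 / 45 * real n ^ 4\<bar>)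
    \<le> 54 * (real n ^ 3 * rn)"
proof -
  define S where "S = (\<Sum>(v, x)\<in>pairs. (centred_chords v x)\<^sup>2)"
  define Y where "Y = (\<lambda>T. \<Sum>(v, x)\<in>pairs. centred_chords v x * centred_chords v (toward T v x))"
  define U where "U = (\<lambda>T. edge_sum T (\<lambda>a b. (centred_chords a b)\<^sup>2))"
  define R where "R = (\<lambda>T. \<Sum>(v, x)\<in>pairs. \<bar>deviation T v x - deviation T v (toward T v x)\<bar>)"
  have n0: "real n > 0" using n by simp
  have sym: "symmetric (\<lambda>a b. (centred_chords a b)\<^sup>2)" using symmetric_centred_chords by (simp add: symmetric_def)
  \<comment> \<open>The main term: \<open>S\<close> is about n^6/180, and 8/180 = 2/45.\<close>
  have S: "\<bar>4 / (real n)\<^sup>2 * (2 * S) - 2 / 45 * real n ^ 4\<bar> \<le> 4 * (real n ^ 3 * rn)"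
  proof -
    have "4 / (real n)\<^sup>2 * (2 * S) - 2 / 45 * real n ^ 4 = 2 / (45 * (real n)\<^sup>2) * (180 * S - real n ^ 6)"
      using n0 by (simp add: field_simps eval_nat_numeral)
    then have "\<bar>4 / (real n)\<^sup>2 * (2 * S) - 2 / 45 * real n ^ 4\<bar>
        = 2 / (45 * (real n)\<^sup>2) * \<bar>180 * S - real n ^ 6\<bar>"
      by (simp only: abs_mult) simp
    also have "\<dots> \<le> 2 / (45 * (real n)\<^sup>2) * (21 * real n ^ 5)"
      using sum_centred_chords_square unfolding S_def by (intro mult_left_mono) auto
    also have "\<dots> = 42 / 45 * real n ^ 3" using n0 by (simp add: field_simps eval_nat_numeral)
    also have "\<dots> \<le> 4 * (real n ^ 3 * rn)"
    proof -
      have "real n ^ 3 * 1 \<le> real n ^ 3 * rn" using rn by (intro mult_left_mono) auto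
      moreover have "0 \<le> real n ^ 3" by simp
      ultimately show ?thesis by linarith
    qed
    finally show ?thesis .
  qed
  have U: "E (\<lambda>T. \<bar>real n / 2 * U T - S\<bar>) \<le> 3 / 2 * (real n ^ 5 * rn)"
  proof -
    have "E (\<lambda>T. \<bar>real n / 2 * U T - S\<bar>) = E (\<lambda>T. real n / 2 * \<bar>U T - 2 / real n * S\<bar>)"
    proof (rule avg_cong)
      fix T
      have "real n / 2 * U T - S = real n / 2 * (U T - 2 / real n * S)"
        using n0 by (simp add: field_simps)
      then show "\<bar>real n / 2 * U T - S\<bar> = real n / 2 * \<bar>U T - 2 / real n * S\<bar>"
        by (simp only: abs_mult)
    qed
    also have "\<dots> = real n / 2 * E (\<lambda>T. \<bar>U T - 2 / real n * S\<bar>)" by (rule avg_cmult)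
    also have "\<dots> \<le> real n / 2 * (3 * (real n ^ 4 * rn))"
    proof (rule mult_left_mono)
      have sq: "(\<Sum>(v, x)\<in>pairs. ((centred_chords v x)\<^sup>2)\<^sup>2) \<le> real n ^ 10"
      proof -
        have "(\<Sum>(v, x)\<in>pairs. ((centred_chords v x)\<^sup>2)\<^sup>2) \<le> (\<Sum>(v, x)\<in>pairs. real n ^ 8)"
        proof (rule sum_pairs_mono)
          fix v x assume "(v, x) \<in> pairs"
          from power_mono[OF centred_chords_bound[OF this], of 4]
          show "((centred_chords v x)\<^sup>2)\<^sup>2 \<le> real n ^ 8" by simp
        qed
        also have "\<dots> = real (card pairs) * real n ^ 8" by (simp add: case_prod_unfold)
        also have "\<dots> \<le> (real n)\<^sup>2 * real n ^ 8" by (intro mult_right_mono card_pairs_le) simp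
        finally show ?thesis by (simp add: eval_nat_numeral)
      qed
      have "E (\<lambda>T. (U T - 2 / real n * S)\<^sup>2) \<le> 8 / real n * (\<Sum>(v, x)\<in>pairs. ((centred_chords v x)\<^sup>2)\<^sup>2)"
        using E_edge_sum_centred_square[OF sym] unfolding U_def S_def .
      also have "\<dots> \<le> 8 / real n * real n ^ 10" using sq by (intro mult_left_mono) auto
      also have "\<dots> = 8 * real n ^ 9" using n0 by (simp add: field_simps eval_nat_numeral)
      finally have "sqrt (E (\<lambda>T. (U T - 2 / real n * S)\<^sup>2)) \<le> sqrt (8 * real n ^ 9)"
        by (rule real_sqrt_le_mono)
      also have "\<dots> = sqrt 8 * (real n ^ 4 * rn)" by (rule sqrt_power_9)
      also have "\<dots> \<le> 3 * (real n ^ 4 * rn)" by (intro mult_right_mono real_le_lsqrt) auto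
      finally show "E (\<lambda>T. \<bar>U T - 2 / real n * S\<bar>) \<le> 3 * (real n ^ 4 * rn)"
        using avg_abs_le_sqrt[of trees "\<lambda>T. U T - 2 / real n * S"] by simp
    qed simp
    also have "\<dots> = 3 / 2 * (real n ^ 5 * rn)" by (simp add: eval_nat_numeral)
    finally show ?thesis .
  qed
  have pw: "\<bar>(\<Sum>(v, x)\<in>pairs. (chord_cr T v x - chord_cr T v (toward T v x))\<^sup>2) - 2 / 45 * real n ^ 4\<bar>
      \<le> 3 * real n * R T + 4 / (real n)\<^sup>2 * (\<bar>real n / 2 * U T - S\<bar> + 2 * \<bar>Y T\<bar>) + 4 * (real n ^ 3 * rn)"
    if T: "T \<in> trees" for T
  proof -
    let ?D = "\<lambda>v x. chord_cr T v x - chord_cr T v (toward T v x)"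
    let ?G = "\<lambda>v x. 2 / real n * (centred_chords v x - centred_chords v (toward T v x))"
    have t: "\<bar>(?D v x)\<^sup>2 - (?G v x)\<^sup>2\<bar> \<le> 3 * real n * \<bar>deviation T v x - deviation T v (toward T v x)\<bar>"
      if vx: "(v, x) \<in> pairs" for v x
    proof -
      have d: "?D v x - ?G v x = deviation T v x - deviation T v (toward T v x)"
        by (simp add: deviation_def centred_chords_def right_diff_distrib)
      have "\<bar>?D v x\<bar> \<le> real n"
        using chord_cr_bounds[OF T, of v x] chord_cr_bounds[OF T, of v "toward T v x"] by (auto simp: abs_le_iff)
      moreover have "\<bar>?G v x\<bar> \<le> 2 * real n"
      proof -
        have "\<bar>centred_chords v x - centred_chords v (toward T v x)\<bar> \<le> (real n)\<^sup>2"
          using crossing_chords_bounds[OF vx] crossing_chords_bounds[OF toward_pairs(1)[OF T vx]]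
          by (simp add: centred_chords_def abs_le_iff)
        then have "2 / real n * \<bar>centred_chords v x - centred_chords v (toward T v x)\<bar> \<le> 2 / real n * (real n)\<^sup>2"
          by (intro mult_left_mono) auto
        then show ?thesis unfolding abs_mult using n0 by (simp add: power2_eq_square)
      qed
      ultimately have "\<bar>?D v x + ?G v x\<bar> \<le> 3 * real n" by linarith
      then have "\<bar>?D v x + ?G v x\<bar> * \<bar>?D v x - ?G v x\<bar> \<le> 3 * real n * \<bar>?D v x - ?G v x\<bar>"
        by (intro mult_right_mono) auto
      moreover have "(?D v x)\<^sup>2 - (?G v x)\<^sup>2 = (?D v x + ?G v x) * (?D v x - ?G v x)"
        by (simp only: power2_eq_square) (simp only: algebra_simps)
      ultimately show ?thesis unfolding d by (simp add: abs_mult)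
    qed
    have 1: "\<bar>(\<Sum>(v, x)\<in>pairs. (?D v x)\<^sup>2) - (\<Sum>(v, x)\<in>pairs. (?G v x)\<^sup>2)\<bar> \<le> 3 * real n * R T"
    proof -
      have "\<bar>\<Sum>(v, x)\<in>pairs. (?D v x)\<^sup>2 - (?G v x)\<^sup>2\<bar> \<le> (\<Sum>(v, x)\<in>pairs. \<bar>(?D v x)\<^sup>2 - (?G v x)\<^sup>2\<bar>)"
        unfolding case_prod_unfold by (rule sum_abs)
      also have "\<dots> \<le> (\<Sum>(v, x)\<in>pairs. 3 * real n * \<bar>deviation T v x - deviation T v (toward T v x)\<bar>)"
        using t by (rule sum_pairs_mono)
      finally show ?thesis unfolding sum_pairs_diff sum_pairs_cmult R_def .
    qed
    have "(\<Sum>(v, x)\<in>pairs. (?G v x)\<^sup>2)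
        = (\<Sum>(v, x)\<in>pairs. 4 / (real n)\<^sup>2 * ((centred_chords v x)\<^sup>2 + (centred_chords v (toward T v x))\<^sup>2 
          - 2 * (centred_chords v x * centred_chords v (toward T v x))))"
      by (rule sum_pairs_cong) (simp add: power2_eq_square algebra_simps)
    also have "\<dots> = 4 / (real n)\<^sup>2 * (S + real n / 2 * U T - 2 * Y T)"
      unfolding sum_pairs_cmult sum_pairs_diff sum_pairs_add S_def Y_def U_def
        sum_toward_eq_edge_sum[OF T sym, symmetric] ..
    finally have G: "(\<Sum>(v, x)\<in>pairs. (?G v x)\<^sup>2) = 4 / (real n)\<^sup>2 * (S + real n / 2 * U T - 2 * Y T)" .
    have alg: "c * (a + u - y) - c * (2 * a) = c * ((u - a) - y)" for a c u y :: real
      by (simp add: algebra_simps)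
    have 2: "(\<Sum>(v, x)\<in>pairs. (?G v x)\<^sup>2) - 4 / (real n)\<^sup>2 * (2 * S)
        = 4 / (real n)\<^sup>2 * ((real n / 2 * U T - S) - 2 * Y T)"
      unfolding G by (rule alg)
    have 3: "\<bar>(\<Sum>(v, x)\<in>pairs. (?G v x)\<^sup>2) - 4 / (real n)\<^sup>2 * (2 * S)\<bar>
        \<le> 4 / (real n)\<^sup>2 * (\<bar>real n / 2 * U T - S\<bar> + 2 * \<bar>Y T\<bar>)"
    proof -
      have "\<bar>(real n / 2 * U T - S) - 2 * Y T\<bar> \<le> \<bar>real n / 2 * U T - S\<bar> + 2 * \<bar>Y T\<bar>" by linarith
      then have "4 / (real n)\<^sup>2 * \<bar>(real n / 2 * U T - S) - 2 * Y T\<bar>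
          \<le> 4 / (real n)\<^sup>2 * (\<bar>real n / 2 * U T - S\<bar> + 2 * \<bar>Y T\<bar>)"
        by (intro mult_left_mono) auto
      moreover have "\<bar>4 / (real n)\<^sup>2\<bar> = 4 / (real n)\<^sup>2" by simp
      ultimately show ?thesis unfolding 2 abs_mult by (simp only:)
    qed
    show ?thesis using 1 3 S by linarith
  qed
  have "E (\<lambda>T. \<bar>(\<Sum>(v, x)\<in>pairs. (chord_cr T v x - chord_cr T v (toward T v x))\<^sup>2) - 2 / 45 * real n ^ 4\<bar>)
      \<le> E (\<lambda>T. 3 * real n * R T + 4 / (real n)\<^sup>2 * (\<bar>real n / 2 * U T - S\<bar> + 2 * \<bar>Y T\<bar>) + 4 * (real n ^ 3 * rn))"
    using pw by (rule avg_mono)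
  also have "\<dots> = 3 * real n * E R + 4 / (real n)\<^sup>2 * (E (\<lambda>T. \<bar>real n / 2 * U T - S\<bar>) + 2 * E (\<lambda>T. \<bar>Y T\<bar>))
      + 4 * (real n ^ 3 * rn)"
    unfolding avg_add avg_cmult E_const ..
  also have "\<dots> \<le> 3 * real n * (2 * (real n)\<^sup>2 * (2 * rn))
      + 4 / (real n)\<^sup>2 * (3 / 2 * (real n ^ 5 * rn) + 2 * (4 * real n ^ 5 * rn)) + 4 * (real n ^ 3 * rn)"
  proof (intro add_mono mult_left_mono U order.refl)
    have "sqrt (2 * real n) \<le> 2 * rn"
      unfolding real_sqrt_mult by (intro mult_right_mono real_le_lsqrt) auto
    then have "2 * (real n)\<^sup>2 * sqrt (2 * real n) \<le> 2 * (real n)\<^sup>2 * (2 * rn)"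
      by (intro mult_left_mono) auto
    with E_sum_deviation show "E R \<le> 2 * (real n)\<^sup>2 * (2 * rn)" unfolding R_def by linarith
    show "E (\<lambda>T. \<bar>Y T\<bar>) \<le> 4 * real n ^ 5 * rn" unfolding Y_def by (rule E_abs_covariance_le)
  qed auto
  also have "\<dots> = 54 * (real n ^ 3 * rn)"
    using n0 by (simp add: field_simps eval_nat_numeral)
  finally show ?thesis .
qed

section \<open>Agreement with the crossing count over quadruples\<close>

lemma sum_pairs_ordered:
  fixes g :: "nat \<Rightarrow> nat \<Rightarrow> real"
  assumes "\<And>a b. g a b = g b a"
  shows "(\<Sum>(a, b)\<in>pairs. g a b) = 2 * (\<Sum>(a, b)\<in>{(a, b). a \<in> V \<and> b \<in> V \<and> a < b}. g a b)"
proof -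
  let ?O = "{(a, b). a \<in> V \<and> b \<in> V \<and> a < b}" and ?O' = "{(a, b). a \<in> V \<and> b \<in> V \<and> b < a}"
  have fin: "finite ?O" "finite ?O'"
    by (rule finite_subset[of _ "V \<times> V"], auto)+
  have split: "pairs = ?O \<union> ?O'" by (auto simp: pairs_def)
  have "(\<Sum>(a, b)\<in>pairs. g a b) = (\<Sum>(a, b)\<in>?O. g a b) + (\<Sum>(a, b)\<in>?O'. g a b)"
    unfolding split by (rule sum.union_disjoint[OF fin]) auto
  also have "(\<Sum>(a, b)\<in>?O'. g a b) = (\<Sum>(a, b)\<in>?O. g a b)"
    by (rule sum.reindex_bij_witness[where i = "\<lambda>(a, b). (b, a)" and j = "\<lambda>(a, b). (b, a)"])
      (auto simp: assms)
  finally show ?thesis by simp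
qed

text \<open>The 8 consists of two orientations of each edge and the order of the two edges;
  \<open>h\<close> selects the interleaving in which the first edge has the smaller left
  end.\<close>

lemma crossings_eq_crossing_number: "real (crossings n T) = crossing_number T"
proof -
  let ?O = "{(a, b). a \<in> V \<and> b \<in> V \<and> a < b}"
  let ?Q = "{(a, b, c, d). 1 \<le> a \<and> a < b \<and> b < c \<and> c < d \<and> d \<le> n}"
  have finO: "finite ?O" by (rule finite_subset[of _ "V \<times> V"]) auto
  define h where "h = (\<lambda>a c b d. edge_ind T a c * edge_ind T b d * of_bool (a < b \<and> b < c \<and> c < d))"
  have "8 * crossing_number T = (\<Sum>(v, x)\<in>pairs. \<Sum>(y, z)\<in>pairs. edge_ind T v x * (cross_ind v x y z * edge_ind T y z))"
    unfolding crossing_number_def chord_cr_def edge_sum_def case_prod_unfold by (simp add: sum_distrib_left sum_divide_distrib)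
  also have "\<dots> = 2 * (\<Sum>(v, x)\<in>?O. \<Sum>(y, z)\<in>pairs. edge_ind T v x * (cross_ind v x y z * edge_ind T y z))"
    by (rule sum_pairs_ordered) (subst cross_ind_commute(1), simp add: edge_ind_commute)
  also have "\<dots> = 2 * (\<Sum>(v, x)\<in>?O. 2 * (\<Sum>(y, z)\<in>?O. edge_ind T v x * (cross_ind v x y z * edge_ind T y z)))"
    by (subst sum_pairs_ordered) (subst cross_ind_commute(2), simp add: edge_ind_commute, simp)
  also have "\<dots> = 4 * (\<Sum>(v, x)\<in>?O. \<Sum>(y, z)\<in>?O. edge_ind T v x * (cross_ind v x y z * edge_ind T y z))"
    unfolding case_prod_unfold by (simp flip: sum_distrib_left)
  also have "(\<Sum>(v, x)\<in>?O. \<Sum>(y, z)\<in>?O. edge_ind T v x * (cross_ind v x y z * edge_ind T y z))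
      = (\<Sum>(v, x)\<in>?O. \<Sum>(y, z)\<in>?O. h v x y z + h y z v x)"
  proof (rule sum.cong[OF refl], clarify, rule sum.cong[OF refl], clarify)
    fix a c b d :: nat assume "a < c" "b < d"
    then have "cross_ind a c b d = of_bool (a < b \<and> b < c \<and> c < d) + of_bool (b < a \<and> a < d \<and> d < c)"
      by (auto simp: cross_ind_def crosses_def)
    then show "edge_ind T a c * (cross_ind a c b d * edge_ind T b d) = h a c b d + h b d a c"
      by (simp add: h_def algebra_simps)
  qed
  also have "\<dots> = (\<Sum>(v, x)\<in>?O. \<Sum>(y, z)\<in>?O. h v x y z) + (\<Sum>(v, x)\<in>?O. \<Sum>(y, z)\<in>?O. h y z v x)"
    unfolding case_prod_unfold by (simp add: sum.distrib)
  also have "(\<Sum>(v, x)\<in>?O. \<Sum>(y, z)\<in>?O. h y z v x) = (\<Sum>(v, x)\<in>?O. \<Sum>(y, z)\<in>?O. h v x y z)"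
    unfolding case_prod_unfold by (rule sum.swap)
  finally have "crossing_number T = (\<Sum>(v, x)\<in>?O. \<Sum>(y, z)\<in>?O. h v x y z)" by simp
  also have "\<dots> = (\<Sum>((a, c), (b, d))\<in>?O \<times> ?O. h a c b d)"
    by (simp add: sum.cartesian_product case_prod_unfold)
  also have "\<dots> = (\<Sum>((a, c), (b, d))\<in>{((a, c), (b, d)). (a, b, c, d) \<in> ?Q}. h a c b d)"
    by (rule sum.mono_neutral_right[OF finite_cartesian_product[OF finO finO]]) (auto simp: h_def)
  also have "\<dots> = (\<Sum>(a, b, c, d)\<in>?Q. of_bool ({a, c} \<in> T) * of_bool ({b, d} \<in> T))"
    by (rule sum.reindex_bij_witness[where i = "\<lambda>(a, b, c, d). ((a, c), (b, d))"
          and j = "\<lambda>((a, c), (b, d)). (a, b, c, d)"]) (auto simp: h_def edge_ind_def)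
  also have "\<dots> = real (crossings n T)"
    unfolding crossings_def of_nat_sum by (intro sum.cong refl) auto
  finally show ?thesis ..
qed

section \<open>Normalisation and explicit constants\<close>

definition scale :: real where "scale = sqrt (real n ^ 3 / 45)"

lemma scale: "scale > 0" "scale\<^sup>2 = real n ^ 3 / 45" "real n / scale \<le> 7 / rn"
proof -
  show "scale > 0" "scale\<^sup>2 = real n ^ 3 / 45" using n by (auto simp: scale_def)
  have "real n ^ 3 / 45 = (real n)\<^sup>2 * real n / 45" by (simp add: eval_nat_numeral)
  then have scale_eq: "scale = real n * rn / sqrt 45"
    unfolding scale_def by (simp add: real_sqrt_mult real_sqrt_divide)
  have "real n / scale = sqrt 45 / rn" unfolding scale_eq using n by (simp add: field_simps)
  also have "\<dots> \<le> 7 / rn" by (intro divide_right_mono real_le_lsqrt) auto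
  finally show "real n / scale \<le> 7 / rn" .
qed

lemma normalized_crossings_eq: "normalized_crossings n T = (crossing_number T - (real n)\<^sup>2 / 6) / scale"
  by (simp add: normalized_crossings_def crossings_eq_crossing_number scale_def)

definition jump :: "nat set set \<Rightarrow> nat \<times> nat \<Rightarrow> real" where
  "jump T = (\<lambda>(v, x). (chord_cr T v x - chord_cr T v (toward T v x)) / scale)"

definition jump_error :: "nat set set \<Rightarrow> nat \<times> nat \<Rightarrow> real" where
  "jump_error T = (\<lambda>(v, x). (deviation T v x - deviation T v (toward T v x)) / (2 * scale))"

lemma normalized_crossings_swap:
  assumes "T \<in> trees" "(v, x) \<in> pairs"
  shows "normalized_crossings n (swap T v x) = normalized_crossings n T + jump T (v, x)"
  unfolding normalized_crossings_eq crossing_number_swap[OF assms] jump_def by (simp flip: add_divide_distrib)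

text \<open>Origin of the parameters: 1/(2n) undoes the factor 2n of the Stein identity; the shift
  compares the true mean with n^2/6; the jump bound uses \<open>sqrt 45 \<le> 7\<close>; the bound 7
  on the defect is 7 * sqrt 2 / 2 rounded up; 1215 = 45 * 54 / 2; and 25 rounds up 49/2.\<close>

lemma stein_pair:
  "bounded_stein_pair trees pairs (normalized_crossings n) jump jump_error
     (1 / (2 * real n)) ((mean_crossings - (real n)\<^sup>2 / 6) / scale) (7 / rn) 7 (1215 / rn) 25"
proof
  have n0: "real n > 0" using n by simp
  let ?W = "normalized_crossings n" and ?c = "1 / (2 * real n)" and ?\<rho> = "(mean_crossings - (real n)\<^sup>2 / 6) / scale"
  show "finite trees" "trees \<noteq> {}" by (rule finite_trees, rule trees_nonempty)
  show "0 \<le> ?c" "0 \<le> 7 / rn" by auto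
  show "E (\<lambda>T. ?W T * f (?W T)) = E (\<lambda>T. \<Sum>i\<in>pairs. ?c * (jump T i - jump_error T i) * (f (?W T + jump T i) - f (?W T)))
      + ?\<rho> * E (\<lambda>T. f (?W T))" for f
  proof -
    define F where "F = (\<lambda>T. f (?W T))"
    have "E (\<lambda>T. \<Sum>i\<in>pairs. ?c * (jump T i - jump_error T i) * (f (?W T + jump T i) - f (?W T)))
        = E (\<lambda>T. 1 / (2 * real n * scale) * (\<Sum>(v, x)\<in>pairs.
          ((chord_cr T v x - chord_cr T v (toward T v x))
            - (deviation T v x - deviation T v (toward T v x)) / 2) * (F (swap T v x) - F T)))"
      unfolding sum_pairs_cmult[symmetric]
    proof (intro avg_cong sum.cong refl)
      fix T i assume T: "T \<in> trees" and i: "i \<in> pairs"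
      obtain v x where vx: "i = (v, x)" by (cases i)
      have "F (swap T v x) = f (?W T + jump T i)"
        unfolding F_def vx using i normalized_crossings_swap[OF T] vx by simp
      then show "?c * (jump T i - jump_error T i) * (f (?W T + jump T i) - f (?W T)) =
        (case i of (v, x) \<Rightarrow> 1 / (2 * real n * scale) *
          (((chord_cr T v x - chord_cr T v (toward T v x))
            - (deviation T v x - deviation T v (toward T v x)) / 2) * (F (swap T v x) - F T)))"
        unfolding vx by (simp add: jump_def jump_error_def F_def divide_simps)
    qed
    also have "\<dots> = 1 / (2 * real n * scale) * (2 * real n * E (\<lambda>T. (crossing_number T - mean_crossings) * F T))"
      unfolding avg_cmult E_crossing_number_stein ..
    also have "\<dots> = E (\<lambda>T. 1 / scale * ((crossing_number T - mean_crossings) * F T))"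
      unfolding avg_cmult using n0 by simp
    also have "\<dots> = E (\<lambda>T. ?W T * f (?W T) - ?\<rho> * F T)"
      by (intro avg_cong) (use scale(1) in \<open>simp add: normalized_crossings_eq F_def field_simps\<close>)
    also have "\<dots> = E (\<lambda>T. ?W T * f (?W T)) - ?\<rho> * E F"
      unfolding avg_diff avg_cmult ..
    finally show ?thesis unfolding F_def by simp
  qed
  show "\<bar>jump T i\<bar> \<le> 7 / rn" if T: "T \<in> trees" for T i
  proof (cases i)
    case (Pair v x)
    have "\<bar>chord_cr T v x - chord_cr T v (toward T v x)\<bar> \<le> real n"
      using chord_cr_bounds[OF T, of v x] chord_cr_bounds[OF T, of v "toward T v x"] by (auto simp: abs_le_iff)
    then have "\<bar>jump T i\<bar> \<le> real n / scale" unfolding Pair jump_def using scale(1) by (simp add: divide_right_mono)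
    with scale(3) show ?thesis by linarith
  qed
  show "E (\<lambda>T. \<Sum>i\<in>pairs. ?c * \<bar>jump_error T i\<bar>) \<le> 7"
  proof -
    have "E (\<lambda>T. \<Sum>i\<in>pairs. ?c * \<bar>jump_error T i\<bar>)
        = E (\<lambda>T. 1 / (4 * real n * scale) * (\<Sum>(v, x)\<in>pairs. \<bar>deviation T v x - deviation T v (toward T v x)\<bar>))"
      unfolding sum_pairs_cmult[symmetric]
      by (intro avg_cong sum.cong refl) (use scale(1) in \<open>auto simp: jump_error_def\<close>)
    also have "\<dots> \<le> 1 / (4 * real n * scale) * (2 * (real n)\<^sup>2 * sqrt (2 * real n))"
      unfolding avg_cmult using scale(1) by (intro mult_left_mono E_sum_deviation) auto
    also have "\<dots> = (real n / scale) * (sqrt 2 * rn / 2)"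
      using n0 scale(1) by (simp add: real_sqrt_mult power2_eq_square field_simps)
    also have "\<dots> \<le> (7 / rn) * (2 * rn / 2)"
      using scale rn by (intro mult_mono divide_right_mono mult_right_mono real_le_lsqrt) auto
    also have "\<dots> = 7" using rn by simp
    finally show ?thesis .
  qed
  show "E (\<lambda>T. \<bar>1 - (\<Sum>i\<in>pairs. ?c * (jump T i)\<^sup>2)\<bar>) \<le> 1215 / rn"
  proof -
    let ?S = "\<lambda>T. \<Sum>(v, x)\<in>pairs. (chord_cr T v x - chord_cr T v (toward T v x))\<^sup>2"
    have "E (\<lambda>T. \<bar>1 - (\<Sum>i\<in>pairs. ?c * (jump T i)\<^sup>2)\<bar>) = E (\<lambda>T. 45 / (2 * real n ^ 4) * \<bar>?S T - 2 / 45 * real n ^ 4\<bar>)"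
    proof (rule avg_cong)
      fix T
      have "(\<Sum>i\<in>pairs. ?c * (jump T i)\<^sup>2) = 45 / (2 * real n ^ 4) * ?S T"
        unfolding sum_pairs_cmult[symmetric]
      proof (rule sum.cong[OF refl], clarify)
        fix v x
        have "?c * (d\<^sup>2 / (real n ^ 3 / 45)) = 45 / (2 * real n ^ 4) * d\<^sup>2" for d
          by (simp add: eval_nat_numeral)
        then show "?c * (jump T (v, x))\<^sup>2 = 45 / (2 * real n ^ 4) * (chord_cr T v x - chord_cr T v (toward T v x))\<^sup>2"
          by (simp only: jump_def power_divide scale(2) prod.case)
      qed
      then have "1 - (\<Sum>i\<in>pairs. ?c * (jump T i)\<^sup>2) = - (45 / (2 * real n ^ 4) * (?S T - 2 / 45 * real n ^ 4))"
        using n0 by (simp add: field_simps)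
      then show "\<bar>1 - (\<Sum>i\<in>pairs. ?c * (jump T i)\<^sup>2)\<bar> = 45 / (2 * real n ^ 4) * \<bar>?S T - 2 / 45 * real n ^ 4\<bar>"
        by (simp only: abs_minus_cancel abs_mult) simp
    qed
    also have "\<dots> \<le> 45 / (2 * real n ^ 4) * (54 * (real n ^ 3 * rn))"
      unfolding avg_cmult by (intro mult_left_mono E_variance) simp
    also have "\<dots> = 1215 * (rn / real n)" using n0 by (simp add: field_simps eval_nat_numeral)
    also have "rn / real n = 1 / rn" using n0 rn by (simp add: field_simps)
    finally show ?thesis by simp
  qed
  show "?c * real (card pairs) * (7 / rn)\<^sup>2 \<le> 25"
  proof -
    have "?c * real (card pairs) * (7 / rn)\<^sup>2 \<le> ?c * (real n)\<^sup>2 * (7 / rn)\<^sup>2"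
      by (intro mult_right_mono mult_left_mono card_pairs_le) auto
    also have "\<dots> = 49 / 2" using n0 by (simp add: power_divide power2_eq_square)
    also have "\<dots> \<le> 25" by simp
    finally show ?thesis .
  qed
qed

lemma kolmogorov_distance:
  "\<bar>E (\<lambda>T. of_bool (normalized_crossings n T \<le> z)) - Phi z\<bar> \<le> 300000 / rn"
proof -
  define \<rho> where "\<rho> = (mean_crossings - (real n)\<^sup>2 / 6) / scale"
  interpret bounded_stein_pair trees pairs "normalized_crossings n" jump jump_error
      "1 / (2 * real n)" \<rho> "7 / rn" 7 "1215 / rn" 25
    unfolding \<rho>_def by (rule stein_pair)
  define t where "t = 1 / rn"
  have t: "0 \<le> t" "t \<le> 1" "7 / rn = 7 * t" "1215 / rn = 1215 * t" using rn by (auto simp: t_def)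
  have \<rho>: "\<bar>\<rho>\<bar> \<le> 7 * t"
  proof -
    have "\<bar>\<rho>\<bar> \<le> real n / scale"
      unfolding \<rho>_def using mean_crossings_bound scale(1) by (simp add: divide_right_mono)
    then show ?thesis using scale(3) t by linarith
  qed
  define m where "m = M"
  \<comment> \<open>82 = 25 + 49 + 7 + 1, as \<open>t\<close> is at most 1.\<close>
  have M: "m \<le> 82" unfolding m_def M_def using \<rho> t by linarith
  have p: "7 * t * (6 + 2 * (m + 7 * t)) \<le> 7 * t * (6 + 2 * (82 + 7))"
    using M t by (intro mult_left_mono) auto
  have q: "(m + \<bar>\<rho>\<bar>) * (2 * (7 * t)) \<le> (82 + 7) * (2 * (7 * t))"
    using M \<rho> t by (intro mult_right_mono) linarith+
  have "\<bar>E (\<lambda>T. of_bool (normalized_crossings n T \<le> z)) - Phi z\<bar>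
      \<le> 2 * (1215 * t) + 25 * (7 * t * (6 + 2 * (m + 7 * t))
        + 4 * ((m + \<bar>\<rho>\<bar>) * (2 * (7 * t)) + 7 * t * 7 + 1215 * t)) + 2 * (7 * t) * 7 + 6 * \<bar>\<rho>\<bar>"
    using kolmogorov_bound[of z] unfolding m_def[symmetric] unfolding t(3,4) .
  \<comment> \<open>The coefficient is 2430 + 25 * (1288 + 4 * 2510) + 98 + 42 = 285770, rounded
    up.\<close>
  also have "\<dots> \<le> 300000 * t"
  proof -
    have "2 * (1215 * t) + 25 * (a + 4 * (b + 7 * t * 7 + 1215 * t)) + 2 * (7 * t) * 7 + 6 * r \<le> 300000 * t"
      if "a \<le> 7 * t * (6 + 2 * (82 + 7))" "b \<le> (82 + 7) * (2 * (7 * t))" "r \<le> 7 * t" for a b r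
    proof -
      have "a \<le> 1288 * t" "b \<le> 1246 * t" using that by simp_all
      then show ?thesis using that(3) t(1) by (simp add: distrib_left)
    qed
    from this[OF p q \<rho>] show ?thesis .
  qed
  finally show ?thesis by (simp add: t_def)
qed

lemma prob_eq_E:
  "measure_pmf.prob (random_tree n) {T. P T} = E (\<lambda>T. of_bool (P T))"
  unfolding random_tree_def avg_def
  using finite_trees trees_nonempty by (simp add: measure_pmf_of_set sum_of_bool_eq)

end

lemma kolmogorov_distance_le:
  assumes "4 \<le> n"
  shows "\<bar>measure_pmf.prob (random_tree n) {T. normalized_crossings n T \<le> z} - Phi z\<bar> \<le> 300000 / sqrt (real n)"
proof -
  interpret convex_trees n using assms by unfold_locales
  show ?thesis unfolding prob_eq_E by (rule kolmogorov_distance)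
qed

theorem theorem1:
  shows "weak_conv_m
           (\<lambda>n. distr (measure_pmf (random_tree n)) borel (normalized_crossings n))
           std_normal_distribution
       \<and> (\<exists>C::real. \<forall>n::nat. n \<ge> 4 \<longrightarrow>
            (SUP z::real. \<bar>measure_pmf.prob (random_tree n) {T. normalized_crossings n T \<le> z}
                            - measure std_normal_distribution {..z}\<bar>)
            \<le> C / sqrt (real n))"
proof (intro conjI exI allI impI)
  show "weak_conv_m (\<lambda>n. distr (measure_pmf (random_tree n)) borel (normalized_crossings n))
      std_normal_distribution"
    unfolding weak_conv_m_def weak_conv_def
  proof (intro allI impI)
    fix z
    have cdf: "cdf (distr (measure_pmf (random_tree n)) borel (normalized_crossings n)) z
        = measure_pmf.prob (random_tree n) {T. normalized_crossings n T \<le> z}" for n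
      unfolding cdf_def by (subst measure_distr) (auto simp: vimage_def)
    \<comment> \<open>The uniform bound gives convergence of the distribution functions at every
      point, hence weak convergence.\<close>
    have "(\<lambda>n. 300000 / sqrt (real n)) \<longlonglongrightarrow> 0" by real_asymp
    moreover have "\<forall>\<^sub>F n in sequentially.
        norm (measure_pmf.prob (random_tree n) {T. normalized_crossings n T \<le> z} - Phi z) \<le> 300000 / sqrt (real n)"
      using eventually_ge_at_top[of 4] by eventually_elim (simp add: kolmogorov_distance_le)
    ultimately have "(\<lambda>n. measure_pmf.prob (random_tree n) {T. normalized_crossings n T \<le> z} - Phi z) \<longlonglongrightarrow> 0"
      by (rule Lim_null_comparison[rotated])
    then show "(\<lambda>n. cdf (distr (measure_pmf (random_tree n)) borel (normalized_crossings n)) z)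
        \<longlonglongrightarrow> cdf std_normal_distribution z"
      unfolding cdf Phi_eq_cdf[symmetric] by (rule LIM_zero_cancel)
  qed
next
  fix n :: nat assume "4 \<le> n"
  then show "(SUP z::real. \<bar>measure_pmf.prob (random_tree n) {T. normalized_crossings n T \<le> z}
      - measure std_normal_distribution {..z}\<bar>) \<le> 300000 / sqrt (real n)"
    by (intro cSUP_least kolmogorov_distance_le) auto
qed

end
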